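(* (1) Every interpretable space $X$ is the image under a continuous open surjection of a $G_\delta$ subspace of a compact space $Z$ such that the weight of $Z$ is no larger than the weight of $X$. (2) Every second countable interpretable space is Polish.
   Context: A space is Čech complete if it is homeomorphic to a $G_\delta$ subspace of a compact Hausdorff space; a space is interpretable if it is regular Hausdorff and the image of a Čech complete space under a continuous open surjection. The weight of a space is the least cardinality of a basis of its topology. *)

theory Defs
  imports "HOL-Analysis.Analysis" "HOL-Library.Equipollence"
begin

text \<open>Cech complete: homeomorphic to a G-delta subspace of a compact Hausdorff space.
  The compact space is taken in an arbitrary type 'c (given by the first argument);
  in the main theorem 'c is a free (hence universally quantified) type variable.\<close>
definition cech_complete_via :: "'c itself \<Rightarrow> 'b topology \<Rightarrow> bool" where
  "cech_complete_via (_::'c itself) Y \<equiv>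
     (\<exists>(K::'c topology) S. compact_space K \<and> Hausdorff_space K \<and> gdelta_in K S \<and>
        Y homeomorphic_space subtopology K S)"

definition interpretable_via :: "'b itself \<Rightarrow> 'c itself \<Rightarrow> 'a topology \<Rightarrow> bool" where
  "interpretable_via (_::'b itself) (_::'c itself) X \<equiv>
     regular_space X \<and> Hausdorff_space X \<and>
     (\<exists>(Y::'b topology) f. cech_complete_via TYPE('c) Y \<and>
        continuous_map Y X f \<and> open_map Y X f \<and> f ` topspace Y = topspace X)"

definition is_basis :: "'a topology \<Rightarrow> 'a set set \<Rightarrow> bool" where
  "is_basis X \<B> \<equiv> (\<forall>V \<in> \<B>. openin X V) \<and>
     (\<forall>U x. openin X U \<and> x \<in> U \<longrightarrow> (\<exists>V \<in> \<B>. x \<in> V \<and> V \<subseteq> U))"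

text \<open>weight Z \<le> weight X: since weights are least cardinalities of bases, this holds
  iff every basis of X has at least the cardinality of some basis of Z.\<close>
definition weight_le :: "'b topology \<Rightarrow> 'a topology \<Rightarrow> bool" where
  "weight_le Z X \<equiv> \<forall>\<B>. is_basis X \<B> \<longrightarrow> (\<exists>\<C>. is_basis Z \<C> \<and> \<C> \<lesssim> \<B>)"

definition Polish_space :: "'a topology \<Rightarrow> bool" where
  "Polish_space X \<equiv> completely_metrizable_space X \<and> separable_space X"

end

theory Submission
  imports Defs
begin

text \<open>Let \<open>X\<close> be the image of a G-delta set \<open>S\<close> of a compact Hausdorff space \<open>K\<close> under a continuous
  open map. Shrinking open sets of \<open>K\<close> step by step inside the open sets defining \<open>S\<close>, and
  projecting them, gives a tree of members of any prescribed basis of \<open>X\<close> along whose branches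
  open covers of the intersection cover a member of the branch.

  For (1), the pairs of a branch and a point of its intersection form a space that projects onto
  \<open>X\<close> by an open map, whose weight is at most that of \<open>X\<close> if the basis is infinite and minimal.
  Although \<open>X\<close> is only regular, the space of pairs is a perfect preimage of a
  zero-dimensional metrizable space, hence normal. So it embeds into a cube of that weight, and
  completeness of the branches makes it a G-delta in its closure. If \<open>X\<close> has a finite basis, it
  is a finite discrete space.

  For (2), \<open>X\<close> itself embeds into a countable cube, where the same completeness, applied to the
  branch that follows the first possible child at each node, exhibits \<open>X\<close> as a G-delta in its
  closure.\<close>

section \<open>Weight and embeddings into cubes\<close>

lemma lepoll_iff_card_of: "A \<lesssim> B \<longleftrightarrow> (card_of A, card_of B) \<in> ordLeq"
  by (simp add: lepoll_def card_of_ordLeq)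

lemma times_lepoll_infinite: "infinite C \<Longrightarrow> A \<lesssim> C \<Longrightarrow> B \<lesssim> C \<Longrightarrow> A \<times> B \<lesssim> C"
  unfolding lepoll_iff_card_of 
  using ordLeq_transitive[OF ordLeq_transitive[OF card_of_Times_mono1 card_of_Times_mono2]
      ordIso_imp_ordLeq[OF card_of_Times_same_infinite]] by blast

text \<open>An infinite set absorbs its square, so by induction the lists of each fixed length
  inject into \<open>A\<close>; it also absorbs the countable union of these over all
  lengths.\<close>

lemma lists_lepoll_infinite:
  assumes "infinite A"
  shows "lists A \<lesssim> A"
proof -
  have "{xs \<in> lists A. length xs = n} \<lesssim> A" for n
  proof (induction n)
    case 0
    have "{xs \<in> lists A. length xs = 0} = {[]}" by auto
    then show ?case
      using assms by (metis finite.emptyI finite.insertI finite_lepoll_infinite)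
  next
    case (Suc n)
    have "{xs \<in> lists A. length xs = Suc n}
      \<subseteq> (\<lambda>(x,xs). x # xs) ` (A \<times> {xs \<in> lists A. length xs = n})"
      by (auto simp: length_Suc_conv image_iff)
    then have "{xs \<in> lists A. length xs = Suc n} \<lesssim> A \<times> {xs \<in> lists A. length xs = n}"
      by (meson image_lepoll lepoll_trans subset_imp_lepoll)
    also have "\<dots> \<lesssim> A"
      using Suc assms by (intro times_lepoll_infinite) auto
    finally show ?case .
  qed
  then have "(card_of (\<Union>n::nat. {xs \<in> lists A. length xs = n}), card_of A) \<in> ordLeq"
    using assms
    by (intro card_of_UNION_ordLeq_infinite)
      (auto simp: lepoll_iff_card_of infinite_iff_card_of_nat)
  moreover have "(\<Union>n::nat. {xs \<in> lists A. length xs = n}) = lists A"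
    by auto
  ultimately show ?thesis
    by (simp add: lepoll_iff_card_of)
qed

section \<open>Bases and their least cardinality\<close>

lemma second_countable_iff_basis: "second_countable X \<longleftrightarrow> (\<exists>\<B>. countable \<B> \<and> is_basis X \<B>)"
  by (simp add: second_countable_def is_basis_def)

text \<open>Makes the collection of bases nonempty, so that a least cardinality among them
  exists.\<close>

lemma is_basis_topspace: "is_basis X (Collect (openin X))"
  unfolding is_basis_def by blast

lemma is_basis_subtopology:
  assumes "is_basis X \<B>"
  shows "is_basis (subtopology X S) ((\<lambda>B. S \<inter> B) ` \<B>)"
  unfolding is_basis_def openin_subtopology_alt
proof (intro conjI ballI allI impI)
  fix U x
  assume "U \<in> (\<inter>) S ` Collect (openin X) \<and> x \<in> U"
  then obtain T where "openin X T" "U = S \<inter> T" "x \<in> T" "x \<in> S" by auto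
  then obtain B where "B \<in> \<B>" "x \<in> B" "B \<subseteq> T"
    using assms unfolding is_basis_def by meson
  then show "\<exists>V\<in>(\<lambda>B. S \<inter> B) ` \<B>. x \<in> V \<and> V \<subseteq> U"
    using \<open>U = _\<close> \<open>x \<in> S\<close> by auto
qed (use assms in \<open>auto simp: is_basis_def\<close>)

text \<open>Cardinals are well-ordered, so the cardinalities of the bases have a least
  member.\<close>

lemma exists_minimal_basis:
  obtains \<B> where "is_basis X \<B>" "\<And>\<C>. is_basis X \<C> \<Longrightarrow> \<B> \<lesssim> \<C>"
proof -
  have "\<exists>r \<in> card_of ` Collect (is_basis X). \<forall>r' \<in> card_of ` Collect (is_basis X). (r, r') \<in> ordLeq"
    by (rule exists_minim_Card_order) (use is_basis_topspace card_of_Card_order in auto)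
  then show thesis
    using that by (auto simp: lepoll_iff_card_of)
qed

lemma weight_le_if_minimal:
  assumes "\<And>\<C>. is_basis X \<C> \<Longrightarrow> \<B> \<lesssim> \<C>" "is_basis Z \<D>" "\<D> \<lesssim> \<B>"
  shows "weight_le Z X"
  using assms unfolding weight_le_def by (meson lepoll_trans)

section \<open>Weight of cubes and embeddings into them\<close>

lemma second_countable_real_unit_interval: "second_countable (top_of_set {0..1::real})"
proof -
  obtain \<B> :: "real set set" where "countable \<B>" "\<And>C. C \<in> \<B> \<Longrightarrow> open C"
    and *: "\<And>S. open S \<Longrightarrow> \<exists>U. U \<subseteq> \<B> \<and> S = \<Union>U"
    using univ_second_countable by blast
  have "\<exists>V\<in>\<B>. x \<in> V \<and> V \<subseteq> U" if "open U" "x \<in> U" for U x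
    using *[OF that(1)] that(2) by blast
  then have "is_basis euclidean \<B>"
    using \<open>\<And>C. C \<in> \<B> \<Longrightarrow> open C\<close> by (simp add: is_basis_def)
  from is_basis_subtopology[OF this] \<open>countable \<B>\<close> show ?thesis
    unfolding second_countable_iff_basis by blast
qed

text \<open>A basic box restricts finitely many coordinates to members of a countable basis, so
  finite lists of pairs (coordinate, basic set) encode all boxes needed. Over an infinite
  \<open>I\<close> there are at most as many such lists as elements of \<open>I\<close>.\<close>

lemma power_topology_basis:
  assumes "infinite I" "second_countable Y"
  shows "\<exists>\<C>. is_basis (product_topology (\<lambda>_. Y) I) \<C> \<and> \<C> \<lesssim> I"
proof -
  obtain \<D> where \<D>: "countable \<D>" "is_basis Y \<D>"
    using assms(2) second_countable_iff_basis by metis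
  \<comment> \<open>Each pair in \<open>l\<close> is one constraint. Intersecting with
    \<open>topspace Y\<close> handles coordinates without constraint, where the empty intersection
    would be the whole type.\<close>
  define box where "box l = (\<Pi>\<^sub>E i\<in>I. topspace Y \<inter> (\<Inter>D \<in> {D. (i,D) \<in> set l}. D))" for l
  let ?C = "box ` lists (I \<times> \<D>)"
  have "openin (product_topology (\<lambda>_. Y) I) (box l)" if "l \<in> lists (I \<times> \<D>)" for l
  proof -
    have l: "set l \<subseteq> I \<times> \<D>" using that by auto
    have "finite {i \<in> I. topspace Y \<inter> (\<Inter>D \<in> {D. (i,D) \<in> set l}. D) \<noteq> topspace Y}"
      by (rule finite_subset[of _ "fst ` set l"]) force+
    moreover have "openin Y (topspace Y \<inter> (\<Inter>D \<in> {D. (i,D) \<in> set l}. D))" for i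
    proof -
      have "{D. (i,D) \<in> set l} \<subseteq> snd ` set l" by force
      then have "finite {D. (i,D) \<in> set l}" using finite_subset by blast
      moreover have "\<And>D. D \<in> {D. (i,D) \<in> set l} \<Longrightarrow> openin Y D"
        using l \<D>(2) by (auto simp: is_basis_def)
      ultimately have "openin Y (\<Inter>(insert (topspace Y) {D. (i,D) \<in> set l}))"
        by (intro openin_Inter) auto
      then show ?thesis by simp
    qed
    ultimately show ?thesis
      unfolding box_def openin_PiE_gen by blast
  qed
  moreover have "\<exists>V\<in>?C. x \<in> V \<and> V \<subseteq> W"
    if W: "openin (product_topology (\<lambda>_. Y) I) W" "x \<in> W" for W x
  proof -
    obtain U where U: "finite {i \<in> I. U i \<noteq> topspace Y}" "\<And>i. i \<in> I \<Longrightarrow> openin Y (U i)"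
      "x \<in> Pi\<^sub>E I U" "Pi\<^sub>E I U \<subseteq> W"
      using W unfolding openin_product_topology_alt by meson
    have "\<exists>D. D \<in> \<D> \<and> x i \<in> D \<and> D \<subseteq> U i" if "i \<in> I" for i
      using that U \<D>(2) unfolding is_basis_def by (meson PiE_mem)
    then obtain D where D: "\<And>i. i \<in> I \<Longrightarrow> D i \<in> \<D> \<and> x i \<in> D i \<and> D i \<subseteq> U i"
      by metis
    from finite_list[OF finite_imageI[OF U(1)]]
    obtain l where l: "set l = (\<lambda>i. (i, D i)) ` {i \<in> I. U i \<noteq> topspace Y}" ..
    have "x i \<in> topspace Y" if "i \<in> I" for i
      using PiE_mem[OF U(3) that] openin_subset[OF U(2)[OF that]] by blast
    then have "x \<in> box l"
      using U(3) D unfolding box_def l by (auto simp: PiE_iff)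
    moreover have "box l \<subseteq> Pi\<^sub>E I U"
      unfolding box_def
    proof (rule PiE_mono)
      fix i assume "i \<in> I"
      show "topspace Y \<inter> (\<Inter>D \<in> {D. (i,D) \<in> set l}. D) \<subseteq> U i"
      proof (cases "U i = topspace Y")
        case False
        then have "(i, D i) \<in> set l" using l \<open>i \<in> I\<close> by auto
        then show ?thesis using D[OF \<open>i \<in> I\<close>] by auto
      qed auto
    qed
    moreover have "l \<in> lists (I \<times> \<D>)"
      using l D by auto
    ultimately show ?thesis using U(4) by blast
  qed
  ultimately have "is_basis (product_topology (\<lambda>_. Y) I) ?C"
    unfolding is_basis_def by blast
  moreover have "?C \<lesssim> I"
  proof -
    have "\<D> \<lesssim> I"
      using \<D>(1) assms(1) lepoll_trans[of \<D> "UNIV::nat set" I]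
      unfolding countable_def infinite_le_lepoll by (auto simp: lepoll_def[of \<D>])
    then have "I \<times> \<D> \<lesssim> I"
      using assms(1) by (simp add: times_lepoll_infinite)
    then have "lists (I \<times> \<D>) \<lesssim> I"
      by (meson assms(1) lists_lepoll_infinite lists_lepoll_mono lepoll_trans)
    then show ?thesis by (meson image_lepoll lepoll_trans)
  qed
  ultimately show ?thesis by blast
qed

text \<open>One coordinate for each functionally separated pair of basic open sets.\<close>

lemma embedding_map_cube_basis:
  assumes X: "completely_regular_space X" "Hausdorff_space X"
    and \<B>: "is_basis X \<B>" and card: "\<B> \<times> \<B> \<lesssim> I"
  shows "\<exists>e. embedding_map X (product_topology (\<lambda>_. top_of_set {0..1::real}) I) e"
proof -
  let ?sep = "\<lambda>P Q h. continuous_map X (top_of_set {0..1::real}) h \<and>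
    h ` P \<subseteq> {0} \<and> h ` (topspace X - Q) \<subseteq> {1}"
  have sep: "\<exists>P\<in>\<B>. \<exists>Q\<in>\<B>. x \<in> P \<and> Q \<subseteq> U \<and> (\<exists>h. ?sep P Q h)"
    if U: "openin X U" "x \<in> U" for U x
  proof -
    obtain Q where Q: "Q \<in> \<B>" "x \<in> Q" "Q \<subseteq> U" "openin X Q"
      using \<B> U unfolding is_basis_def by meson
    then have "closedin X (topspace X - Q)" "x \<in> topspace X - (topspace X - Q)"
      using openin_subset by auto
    then obtain g where g: "continuous_map X (top_of_set {0..1::real}) g" "g x = 0"
      "g ` (topspace X - Q) \<subseteq> {1}"
      using X(1) unfolding completely_regular_space_def by meson
    then have g': "continuous_map X euclideanreal g"
      by (simp add: continuous_map_in_subtopology)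
    have "openin X {y \<in> topspace X. g y \<in> {..<1/2}}"
      using g' by (rule openin_continuous_map_preimage) simp
    moreover have "x \<in> topspace X"
      using U openin_subset by blast
    ultimately obtain P where P: "P \<in> \<B>" "x \<in> P" "P \<subseteq> {y \<in> topspace X. g y \<in> {..<1/2}}"
      using \<B> g(2) unfolding is_basis_def
      by (metis (mono_tags, lifting) half_gt_zero lessThan_iff mem_Collect_eq zero_less_one)
    \<comment> \<open>Rescaling makes the function vanish on all of \<open>P\<close>, not only at
      \<open>x\<close>, while it stays 1 off \<open>Q\<close>. The pair of basic sets is then
      separated without reference to the point.\<close>
    define h where "h y = max 0 (2 * g y - 1)" for y
    have "continuous_map X euclideanreal h"
      unfolding h_def by (intro continuous_intros g')
    moreover have "h y \<in> {0..1}" if "y \<in> topspace X" for y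
      using g(1) that by (auto simp: h_def continuous_map_in_subtopology)
    moreover have "h ` P \<subseteq> {0}"
      using P(3) by (auto simp: h_def)
    moreover have "h ` (topspace X - Q) \<subseteq> {1}"
      using g(3) by (force simp: h_def)
    ultimately have "?sep P Q h"
      by (auto simp: continuous_map_in_subtopology)
    with P Q show ?thesis by blast
  qed
  obtain j where j: "inj_on j (\<B> \<times> \<B>)" "j ` (\<B> \<times> \<B>) \<subseteq> I"
    using card by (auto simp: lepoll_def)
  \<comment> \<open>The injection \<open>j\<close> turns pairs into indices. An index that codes a
    separable pair must carry a separating function; for any other index a constant function will
    do.\<close>
  define good where "good i = (\<lambda>h. continuous_map X (top_of_set {0..1::real}) h \<and>
     (\<forall>P\<in>\<B>. \<forall>Q\<in>\<B>. i = j (P,Q) \<longrightarrow> (\<exists>h. ?sep P Q h) \<longrightarrow> ?sep P Q h))" for i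
  have "\<exists>h. good i h" for i
  proof (cases "\<exists>P\<in>\<B>. \<exists>Q\<in>\<B>. i = j (P,Q) \<and> (\<exists>h. ?sep P Q h)")
    case True
    then obtain P Q h where "P\<in>\<B>" "Q\<in>\<B>" "i = j (P,Q)" "?sep P Q h" by blast
    then have "good i h"
      unfolding good_def using inj_onD[OF j(1)] by (metis SigmaI prod.inject)
    then show ?thesis by blast
  next
    case False
    moreover have "continuous_map X (top_of_set {0..1::real}) (\<lambda>_. 0)"
      by simp
    ultimately show ?thesis unfolding good_def by blast
  qed
  then obtain H where H: "\<And>i. good i (H i)" by metis
  define e where "e x = (\<lambda>i\<in>I. H i x)" for x
  let ?P = "product_topology (\<lambda>_. top_of_set {0..1::real}) I"
  have cont: "continuous_map X ?P e"
    unfolding continuous_map_componentwise e_def using H by (auto simp: good_def eta_contract_eq)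
  have key: "\<exists>W. openin ?P W \<and> e x \<in> W \<and> (\<forall>y\<in>topspace X. e y \<in> W \<longrightarrow> y \<in> U)"
    if U: "openin X U" "x \<in> U" for U x
  proof -
    obtain P Q where PQ: "P \<in> \<B>" "Q \<in> \<B>" "x \<in> P" "Q \<subseteq> U" "\<exists>h. ?sep P Q h"
      using sep[OF U] by blast
    define i where "i = j (P,Q)"
    have i: "i \<in> I" "?sep P Q (H i)"
      using j(2) PQ(1,2) H[of i, unfolded good_def, THEN conjunct2, rule_format, OF PQ(1,2) i_def PQ(5)]
      by (auto simp: i_def)
    \<comment> \<open>Off \<open>Q\<close> the coordinate \<open>i\<close> equals 1, so requiring it
      to be below 1 forces a point of \<open>X\<close> into \<open>Q\<close>, hence into
      \<open>U\<close>.\<close>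
    let ?W = "{f \<in> topspace ?P. f i \<in> {0..<1}}"
    have "openin (top_of_set {0..1}) {0..<1::real}"
      using open_real_greaterThanLessThan[of "-1" 1] by (force simp: openin_open)
    then have "openin ?P ?W"
      by (rule openin_continuous_map_preimage[OF continuous_map_product_projection[OF i(1)]])
    moreover have "e x \<in> ?W"
    proof -
      have "x \<in> topspace X" using U openin_subset by blast
      then have "e x \<in> topspace ?P" using cont continuous_map_image_subset_topspace by blast
      moreover have "H i x = 0" using i(2) PQ(3) by blast
      ultimately show ?thesis using i(1) by (simp add: e_def)
    qed
    moreover have "y \<in> U" if "y \<in> topspace X" "e y \<in> ?W" for y
      using that i PQ(4) by (fastforce simp: e_def)
    ultimately show ?thesis by blast
  qed
  have "inj_on e (topspace X)"
  proof (rule inj_onI, rule ccontr)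
    fix x y assume "x \<in> topspace X" "y \<in> topspace X" "e x = e y" "x \<noteq> y"
    then obtain U where "openin X U" "x \<in> U" "y \<notin> U"
      using X(2) unfolding Hausdorff_space_def by (metis disjnt_iff)
    from key[OF this(1,2)] \<open>e x = e y\<close> \<open>y \<in> topspace X\<close> \<open>y \<notin> U\<close> show False by metis
  qed
  moreover have "open_map X (subtopology ?P (e ` topspace X)) e"
    unfolding open_map_def
  proof (intro allI impI)
    fix U assume U: "openin X U"
    show "openin (subtopology ?P (e ` topspace X)) (e ` U)"
    proof (subst openin_subopen, intro ballI)
      fix z assume "z \<in> e ` U"
      then obtain x where x: "x \<in> U" "z = e x" by auto
      obtain W where W: "openin ?P W" "e x \<in> W" "\<And>y. y\<in>topspace X \<Longrightarrow> e y \<in> W \<Longrightarrow> y \<in> U"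
        using key[OF U x(1)] by metis
      have "openin (subtopology ?P (e ` topspace X)) (e ` topspace X \<inter> W)"
        using W(1) openin_subtopology_Int2 by blast
      moreover have "x \<in> topspace X" using U x openin_subset by blast
      ultimately show "\<exists>T. openin (subtopology ?P (e ` topspace X)) T \<and> z \<in> T \<and> T \<subseteq> e ` U"
        using W x by (intro exI[of _ "e ` topspace X \<inter> W"]) auto
    qed
  qed
  moreover have "continuous_map X (subtopology ?P (e ` topspace X)) e"
    using cont by (simp add: continuous_map_in_subtopology)
  ultimately have "embedding_map X ?P e"
    unfolding embedding_map_def using continuous_map_image_subset_topspace[OF cont]
    by (intro bijective_open_imp_homeomorphic_map) auto
  then show ?thesis by blast
qed

section \<open>Sieves\<close>

text \<open>Initial segments are listed with the latest entry first, so that Cons extends them.\<close>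

definition pre :: "(nat \<Rightarrow> 'b) \<Rightarrow> nat \<Rightarrow> 'b list"
  where "pre \<beta> n = rev (map \<beta> [0..<n])"

lemma pre_0 [simp]: "pre \<beta> 0 = []"
  by (simp add: pre_def)

lemma pre_Suc [simp]: "pre \<beta> (Suc n) = \<beta> n # pre \<beta> n"
  by (simp add: pre_def)

lemma pre_eq_iff: "pre \<beta> n = pre \<gamma> n \<longleftrightarrow> (\<forall>i<n. \<beta> i = \<gamma> i)"
  by (induction n) (auto simp: less_Suc_eq)

lemma length_pre [simp]: "length (pre \<beta> n) = n"
  by (simp add: pre_def)

text \<open>For the members of a decreasing sequence: the intersection is compact, and every
  open superset of it contains a member.\<close>

definition complete_seq :: "'a topology \<Rightarrow> (nat \<Rightarrow> 'a set) \<Rightarrow> bool"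
  where "complete_seq X D \<longleftrightarrow>
    (\<forall>\<U>. (\<forall>U\<in>\<U>. openin X U) \<and> (\<Inter>n. D n) \<subseteq> \<Union>\<U> \<longrightarrow>
       (\<exists>n \<V>. finite \<V> \<and> \<V> \<subseteq> \<U> \<and> D n \<subseteq> \<Union>\<V>))"

lemma complete_seqD:
  assumes "complete_seq X D" "\<And>U. U \<in> \<U> \<Longrightarrow> openin X U" "(\<Inter>n. D n) \<subseteq> \<Union>\<U>"
  obtains n \<V> where "finite \<V>" "\<V> \<subseteq> \<U>" "D n \<subseteq> \<Union>\<V>"
  using assms unfolding complete_seq_def by meson

lemma complete_seq_limit_in_image:
  assumes Z: "Hausdorff_space Z" and e: "continuous_map X Z e"
    and dense: "Z closure_of (e ` topspace X) = topspace Z"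
    and D: "complete_seq X D" "\<And>n. D n \<subseteq> topspace X"
    and G: "\<And>n. openin Z (G n)" "\<And>n. G n \<inter> e ` topspace X \<subseteq> e ` D n" "\<And>n. p \<in> G n"
  shows "p \<in> e ` (\<Inter>n. D n)"
proof (rule ccontr)
  assume p: "p \<notin> e ` (\<Inter>n. D n)"
  define H where "H U = {x \<in> topspace X. e x \<in> U}" for U
  let ?sep = "\<lambda>U V. openin Z U \<and> openin Z V \<and> p \<in> V \<and> disjnt U V"
  define \<U> where "\<U> = {H U |U. \<exists>V. ?sep U V}"
  have pZ: "p \<in> topspace Z" using G(1,3) openin_subset by blast
  have "openin X W" if "W \<in> \<U>" for W
    using that e unfolding \<U>_def H_def by (auto intro: openin_continuous_map_preimage)
  moreover have "(\<Inter>n. D n) \<subseteq> \<Union>\<U>"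
  proof
    fix x assume x: "x \<in> (\<Inter>n. D n)"
    then have "x \<in> topspace X" using D(2) by blast
    then have "e x \<in> topspace Z" using e continuous_map_image_subset_topspace by blast
    moreover have "e x \<noteq> p" using x p by blast
    ultimately obtain U V where "?sep U V" "e x \<in> U"
      using Z pZ unfolding Hausdorff_space_def by meson
    then have "H U \<in> \<U>" "x \<in> H U" using \<open>x \<in> topspace X\<close> by (auto simp: \<U>_def H_def)
    then show "x \<in> \<Union>\<U>" by blast
  qed
  ultimately obtain n \<V> where \<V>: "finite \<V>" "\<V> \<subseteq> \<U>" "D n \<subseteq> \<Union>\<V>"
    by (rule complete_seqD[OF D(1)])
  have "\<exists>V. openin Z V \<and> p \<in> V \<and> e ` W \<inter> V = {}" if W: "W \<in> \<V>" for W
  proof -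
    obtain U V where "W = H U" "?sep U V"
      using W \<V>(2) unfolding \<U>_def by blast
    then show ?thesis unfolding H_def disjnt_def by blast
  qed
  then obtain V where V: "\<And>W. W \<in> \<V> \<Longrightarrow> openin Z (V W) \<and> p \<in> V W \<and> e ` W \<inter> V W = {}"
    by metis
  have "openin Z (\<Inter>(insert (G n) (V ` \<V>)))"
    using \<V>(1) V G(1) by (intro openin_Inter) auto
  moreover have "p \<in> \<Inter>(insert (G n) (V ` \<V>))"
    using V G(3) by auto
  ultimately obtain x where x: "x \<in> topspace X" "e x \<in> G n" "\<And>W. W \<in> \<V> \<Longrightarrow> e x \<in> V W"
    using dense unfolding dense_intersects_open by force
  then obtain y where "y \<in> D n" "e y = e x" using G(2) by force
  then show False using \<V>(3) V x(3) by fastforce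
qed

text \<open>Dependent choice applied to growing lists, which are then read off as the prefixes of
  one infinite sequence. It is used both to follow a point through a sieve and to follow first
  children.\<close>

lemma dependent_list_choice:
  assumes P: "P (pre \<beta> n)" and step: "\<And>s. P s \<Longrightarrow> \<exists>b. P (b # s) \<and> R b"
  shows "\<exists>\<gamma>. pre \<gamma> n = pre \<beta> n \<and> (\<forall>m\<ge>n. P (pre \<gamma> m)) \<and> (\<forall>i\<ge>n. R (\<gamma> i))"
proof -
  \<comment> \<open>The clause for \<open>k = 0\<close> forces the chosen sequence of lists to start
    at the given prefix.\<close>
  let ?P = "\<lambda>(k::nat) s. P s \<and> (k = 0 \<longrightarrow> s = pre \<beta> n)"
  let ?Q = "\<lambda>(k::nat) s s'. \<exists>b. s' = b # s \<and> R b"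
  have "\<exists>f. \<forall>k. ?P k (f k) \<and> ?Q k (f k) (f (Suc k))"
  proof (rule dependent_nat_choice)
    show "\<exists>s. ?P 0 s"
      using P by blast
    fix s k assume "?P k s"
    then show "\<exists>s'. ?P (Suc k) s' \<and> ?Q k s s'"
      using step by blast
  qed
  then obtain f where f: "\<forall>k. ?P k (f k) \<and> ?Q k (f k) (f (Suc k))"
    by blast
  have f0: "f 0 = pre \<beta> n"
    using spec[OF f, of 0] by simp
  have fP: "P (f k)" and fS: "\<exists>b. f (Suc k) = b # f k \<and> R b" for k
    using spec[OF f, of k] by auto
  \<comment> \<open>The list \<open>f k\<close> will be the prefix of length \<open>n + k\<close>,
    so entry \<open>i \<ge> n\<close> is the head of the list with index
    \<open>Suc i - n\<close>.\<close>
  define \<gamma> where "\<gamma> i = (if i < n then \<beta> i else hd (f (Suc i - n)))" for i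
  have f: "f k = pre \<gamma> (n + k)" for k
  proof (induction k)
    case 0
    then show ?case using f0 by (simp add: pre_eq_iff \<gamma>_def)
  next
    case (Suc k)
    obtain b where b: "f (Suc k) = b # f k" using fS by blast
    have "\<gamma> (n + k) = hd (f (Suc k))" by (simp add: \<gamma>_def Suc_diff_le)
    then show ?case using Suc b by simp
  qed
  have "pre \<gamma> n = pre \<beta> n" using f[of 0] f0 by simp
  moreover have "P (pre \<gamma> m)" if "n \<le> m" for m
    using f[of "m - n"] fP[of "m - n"] that by simp
  moreover have "R (\<gamma> i)" if "n \<le> i" for i
  proof -
    have "\<gamma> i = hd (f (Suc (i - n)))" using that by (simp add: \<gamma>_def Suc_diff_le)
    moreover obtain b where "f (Suc (i - n)) = b # f (i - n)" "R b"
      using fS[of "i - n"] by blast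
    ultimately show ?thesis by simp
  qed
  ultimately show ?thesis by blast
qed

text \<open>A tree \<open>N\<close> of open sets in the style of Wicke and Worrell; the open set at a node is its
  latest entry, and the whole space at the root.\<close>

locale sieve =
  fixes X :: "'a topology" and N :: "'a set list set"
  assumes Nil_node: "[] \<in> N"
    and child: "s \<in> N \<Longrightarrow> x \<in> hd (s @ [topspace X]) \<Longrightarrow> \<exists>b. b # s \<in> N \<and> x \<in> b"
    and openin_node: "b # s \<in> N \<Longrightarrow> openin X b"
    and complete: "(\<And>n. pre \<beta> n \<in> N) \<Longrightarrow> complete_seq X \<beta>"
begin

text \<open>The children of a node cover it, so a child containing \<open>x\<close> can be chosen
  again and again. This is the source of surjectivity and openness of the projection from the branch
  space.\<close>

lemma extend_to_branch:
  assumes "\<And>m. m \<le> n \<Longrightarrow> pre \<beta> m \<in> N" "x \<in> topspace X" "\<And>i. i < n \<Longrightarrow> x \<in> \<beta> i"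
  obtains \<gamma> where "pre \<gamma> n = pre \<beta> n" "\<And>m. pre \<gamma> m \<in> N" "\<And>i. x \<in> \<gamma> i"
proof -
  have "x \<in> hd (pre \<beta> n @ [topspace X])"
    using assms(2,3) by (cases n) auto
  then have "pre \<beta> n \<in> N \<and> x \<in> hd (pre \<beta> n @ [topspace X])"
    using assms(1) by blast
  from dependent_list_choice[where P = "\<lambda>s. s \<in> N \<and> x \<in> hd (s @ [topspace X])" and R = "\<lambda>b. x \<in> b", OF this]
  obtain \<gamma> where \<gamma>: "pre \<gamma> n = pre \<beta> n" "\<And>m. m \<ge> n \<Longrightarrow> pre \<gamma> m \<in> N" "\<And>i. i \<ge> n \<Longrightarrow> x \<in> \<gamma> i"
    using child by auto
  show thesis
  proof
    show "pre \<gamma> n = pre \<beta> n" by fact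
    show "pre \<gamma> m \<in> N" for m
    proof (cases "m \<le> n")
      case True
      then have "pre \<gamma> m = pre \<beta> m" using \<gamma>(1) by (simp add: pre_eq_iff)
      then show ?thesis using assms(1) True by simp
    qed (use \<gamma>(2) in simp)
    show "x \<in> \<gamma> i" for i
      using \<gamma>(1,3) assms(3)[of i] by (cases "i < n") (auto simp: pre_eq_iff)
  qed
qed

end

text \<open>The sieve is the image of a tree of open sets \<open>V s\<close> of \<open>K\<close> with closures contained
  in the parent and in the n-th open set of the G-delta. Compactness of \<open>K\<close> makes branches
  complete.\<close>

lemma sieve_of_open_image_of_gdelta:
  assumes K: "compact_space K" "Hausdorff_space K" "gdelta_in K S"
    and f: "continuous_map (subtopology K S) X f" "open_map (subtopology K S) X f"
      "f ` S = topspace X"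
    and \<B>: "is_basis X \<B>"
  shows "\<exists>N. N \<subseteq> lists \<B> \<and> sieve X N"
proof -
  obtain W where W: "\<And>n::nat. openin K (W n)" "\<Inter>(range W) = S"
    using K(3) unfolding gdelta_in_descending by metis
  have SK: "S \<subseteq> topspace K" using W openin_subset by blast
  \<comment> \<open>The closure condition feeds the compactness argument, the set \<open>W n\<close>
    keeps limits inside \<open>S\<close>, and the equation ties the open set of \<open>K\<close> to
    the entry \<open>b\<close> of the sieve.\<close>
  define child where "child V n b V' \<longleftrightarrow> openin K V' \<and> K closure_of V' \<subseteq> V \<inter> W n \<and> f ` (V' \<inter> S) = b"
    for V n b V'
  have child_exists: "\<exists>b\<in>\<B>. x \<in> b \<and> (\<exists>V'. child V n b V')"
    if V: "openin K V" and x: "x \<in> f ` (V \<inter> S)" for V n x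
  proof -
    obtain y where y: "y \<in> V" "y \<in> S" "x = f y" using x by auto
    have "regular_space K"
      using K compact_Hausdorff_imp_regular_space by blast
    moreover have "closedin K (topspace K - V \<inter> W n)" "y \<in> topspace K - (topspace K - V \<inter> W n)"
      using V W y SK by auto
    ultimately obtain V1 where V1: "openin K V1" "y \<in> V1" "disjnt (topspace K - V \<inter> W n) (K closure_of V1)"
      unfolding regular_space by meson
    have cl: "K closure_of V1 \<subseteq> V \<inter> W n"
      using V1(3) closure_of_subset_topspace[of K V1] by (auto simp: disjnt_iff)
    have "openin (subtopology K S) (V1 \<inter> S)"
      using V1(1) openin_subtopology_Int by blast
    then have "openin X (f ` (V1 \<inter> S))"
      using f(2) by (auto simp: open_map_def)
    \<comment> \<open>The image of \<open>V1 \<inter> S\<close> need not be a basis member. A basic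
      \<open>b\<close> is chosen inside it and \<open>V1\<close> is cut down to an open set whose
      trace on \<open>S\<close> projects exactly onto \<open>b\<close>.\<close>
    then obtain b where b: "b \<in> \<B>" "x \<in> b" "b \<subseteq> f ` (V1 \<inter> S)"
      using \<B> y V1(2) unfolding is_basis_def by (metis Int_iff imageI)
    then have "openin X b" using \<B> by (auto simp: is_basis_def)
    then have "openin (subtopology K S) {z \<in> topspace (subtopology K S). f z \<in> b}"
      using f(1) openin_continuous_map_preimage by blast
    then obtain G where G: "openin K G" "{z \<in> topspace (subtopology K S). f z \<in> b} = G \<inter> S"
      unfolding openin_subtopology by auto
    have G': "z \<in> G \<longleftrightarrow> f z \<in> b" if "z \<in> S" for z
      using that G(2) SK by auto
    have "f ` (V1 \<inter> G \<inter> S) = b"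
    proof
      show "f ` (V1 \<inter> G \<inter> S) \<subseteq> b" using G' by blast
      show "b \<subseteq> f ` (V1 \<inter> G \<inter> S)"
      proof
        fix w assume "w \<in> b"
        then obtain z where "z \<in> V1" "z \<in> S" "w = f z" using b(3) by blast
        with G' \<open>w \<in> b\<close> show "w \<in> f ` (V1 \<inter> G \<inter> S)" by blast
      qed
    qed
    moreover have "K closure_of (V1 \<inter> G) \<subseteq> K closure_of V1"
      by (simp add: closure_of_mono)
    ultimately have "child V n b (V1 \<inter> G)"
      using V1(1) G(1) cl by (auto simp: child_def)
    then show ?thesis using b by blast
  qed
  \<comment> \<open>Choosing the open set of \<open>K\<close> along the recursion makes it a
    function of the list alone. The predicate \<open>N\<close> then accepts the lists for which
    every choice was possible.\<close>
  define V where "V = rec_list (topspace K) (\<lambda>b s R. SOME V'. child R (length s) b V')"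
  have V_Nil: "V [] = topspace K" and V_Cons: "V (b # s) = (SOME V'. child (V s) (length s) b V')" for b s
    by (auto simp: V_def)
  define N where "N = rec_list True (\<lambda>b s R. R \<and> b \<in> \<B> \<and> (\<exists>V'. child (V s) (length s) b V'))"
  have N_Nil: "N []" and N_Cons: "N (b # s) \<longleftrightarrow> N s \<and> b \<in> \<B> \<and> (\<exists>V'. child (V s) (length s) b V')" for b s
    by (auto simp: N_def)
  have V: "child (V s) (length s) b (V (b # s))" if "N (b # s)" for b s
    using that someI_ex[of "child (V s) (length s) b"] by (auto simp: N_Cons V_Cons)
  have VN: "openin K (V s)" "f ` (V s \<inter> S) = hd (s @ [topspace X])" if "N s" for s
    using that V f(3) SK by (cases s; force simp: V_Nil child_def Int_absorb1)+
  have "N s \<Longrightarrow> s \<in> lists \<B>" for s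
    by (induction s) (auto simp: N_Cons)
  moreover have "sieve X (Collect N)"
  proof
    show "[] \<in> Collect N" using N_Nil by simp
    show "\<exists>b. b # s \<in> Collect N \<and> x \<in> b" if "s \<in> Collect N" "x \<in> hd (s @ [topspace X])" for s x
      using child_exists[of "V s" x "length s"] VN[of s] that by (auto simp: N_Cons)
    show "openin X b" if "b # s \<in> Collect N" for b s
      using that \<B> by (auto simp: N_Cons is_basis_def)
    show "complete_seq X \<beta>" if "\<And>n. pre \<beta> n \<in> Collect N" for \<beta>
      unfolding complete_seq_def
    proof (intro allI impI, elim conjE)
      fix \<U> assume \<U>: "\<forall>U\<in>\<U>. openin X U" "(\<Inter>n. \<beta> n) \<subseteq> \<Union>\<U>"
      define C where "C n = K closure_of V (pre \<beta> n)" for n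
      have N: "N (pre \<beta> n)" for n using that by simp
      have step: "C (Suc n) \<subseteq> V (pre \<beta> n) \<inter> W n" for n
        using V[of "\<beta> n" "pre \<beta> n"] N[of "Suc n"] by (simp add: C_def child_def)
      have VC: "V (pre \<beta> n) \<subseteq> C n" for n
        unfolding C_def using VN(1)[OF N] by (simp add: closure_of_subset openin_subset)
      have decr: "C n \<subseteq> C m" if "m \<le> n" for m n
        using that
        by (rule lift_Suc_antimono_le[of C, rotated]) (use step VC in blast)
      \<comment> \<open>The entry \<open>\<beta> n\<close> is the latest one in the prefix of length
        \<open>Suc n\<close>, hence the shift.\<close>
      have f\<beta>: "f ` (V (pre \<beta> (Suc n)) \<inter> S) = \<beta> n" for n
        using VN(2)[OF N[of "Suc n"]] by simp
      have "\<exists>G. openin K G \<and> (\<forall>z\<in>S. z \<in> G \<longleftrightarrow> f z \<in> U)" if U: "U \<in> \<U>" for U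
      proof -
        have "openin (subtopology K S) {z \<in> topspace (subtopology K S). f z \<in> U}"
          using U \<U>(1) f(1) openin_continuous_map_preimage by blast
        then obtain G where "openin K G" "{z \<in> topspace (subtopology K S). f z \<in> U} = G \<inter> S"
          unfolding openin_subtopology by auto
        then show ?thesis using SK by (intro exI[of _ G]) auto
      qed
      then obtain G where G: "\<And>U. U \<in> \<U> \<Longrightarrow> openin K (G U)"
        and GU: "\<And>U z. U \<in> \<U> \<Longrightarrow> z \<in> S \<Longrightarrow> z \<in> G U \<longleftrightarrow> f z \<in> U"
        by metis
      \<comment> \<open>A point in all \<open>C n\<close> lies in \<open>S\<close> and is mapped
        into every \<open>\<beta> n\<close>, so some \<open>G U\<close> contains it. Any other point
        lies in the complement of some \<open>C n\<close>; together these open sets cover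
        \<open>K\<close>.\<close>
      have "\<And>T. T \<in> G ` \<U> \<union> range (\<lambda>n. topspace K - C n) \<Longrightarrow> openin K T"
        using G by (auto simp: C_def)
      moreover have "topspace K \<subseteq> \<Union>(G ` \<U> \<union> range (\<lambda>n. topspace K - C n))"
      proof
        fix x assume x: "x \<in> topspace K"
        show "x \<in> \<Union>(G ` \<U> \<union> range (\<lambda>n. topspace K - C n))"
        proof (cases "\<forall>n. x \<in> C n")
          case True
          then have "x \<in> V (pre \<beta> n)" "x \<in> W n" for n using step by blast+
          then have "x \<in> S" "\<And>n. f x \<in> \<beta> n" using W(2) f\<beta> by blast+
          then obtain U where "U \<in> \<U>" "f x \<in> U" using \<U>(2) by blast
          then have "x \<in> G U" using GU \<open>x \<in> S\<close> by simp
          then show ?thesis using \<open>U \<in> \<U>\<close> by blast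
        qed (use x in auto)
      qed
      ultimately obtain \<F> where \<F>: "finite \<F>" "\<F> \<subseteq> G ` \<U> \<union> range (\<lambda>n. topspace K - C n)"
        "topspace K \<subseteq> \<Union>\<F>"
        using K(1) unfolding compact_space_alt by meson
      then obtain \<V> M where \<V>: "\<V> \<subseteq> \<U>" "finite \<V>" "finite M"
        "\<F> = G ` \<V> \<union> (\<lambda>n. topspace K - C n) ` M"
      proof -
        obtain \<V> where "\<V> \<subseteq> \<U>" "finite \<V>" "\<F> \<inter> G ` \<U> = G ` \<V>"
          using finite_subset_image[of "\<F> \<inter> G ` \<U>" G \<U>] \<F>(1) by auto
        moreover obtain M where "finite M"
          "\<F> \<inter> range (\<lambda>n. topspace K - C n) = (\<lambda>n. topspace K - C n) ` M"
          using finite_subset_image[of "\<F> \<inter> range (\<lambda>n. topspace K - C n)" "\<lambda>n. topspace K - C n" UNIV] \<F>(1) by auto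
        moreover have "\<F> = (\<F> \<inter> G ` \<U>) \<union> (\<F> \<inter> range (\<lambda>n. topspace K - C n))"
          using \<F>(2) by blast
        ultimately show thesis using that[of \<V> M] by simp
      qed
      \<comment> \<open>Beyond the largest index in \<open>M\<close> the complements no longer help,
        since the sets \<open>C m\<close> decrease. Points over \<open>\<beta> n\<close> must
        therefore be covered by the sets \<open>G U\<close>.\<close>
      obtain n where n: "\<And>m. m \<in> M \<Longrightarrow> m \<le> n"
        using \<V>(3) finite_nat_set_iff_bounded_le by auto
      have "\<beta> n \<subseteq> \<Union>\<V>"
      proof
        fix x assume "x \<in> \<beta> n"
        then obtain y where y: "y \<in> V (pre \<beta> (Suc n))" "y \<in> S" "x = f y"
          using f\<beta> by blast
        have "y \<in> C m" if "m \<in> M" for m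
          using y(1) VC decr[of m "Suc n"] n[OF that] by force
        moreover have "y \<in> \<Union>\<F>" using \<F>(3) y(2) SK by blast
        ultimately obtain U where "U \<in> \<V>" "y \<in> G U"
          using \<V>(4) by auto
        then show "x \<in> \<Union>\<V>" using GU \<V>(1) y by blast
      qed
      then show "\<exists>n \<V>. finite \<V> \<and> \<V> \<subseteq> \<U> \<and> \<beta> n \<subseteq> \<Union>\<V>"
        using \<V> by blast
    qed
  qed
  ultimately show ?thesis by (intro exI[of _ "Collect N"]) auto
qed

text \<open>Composing the open surjection with a homeomorphism from the G-delta set onto its domain
  reduces to open images of G-delta sets.\<close>

lemma interpretable_imp_sieve:
  assumes "interpretable_via TYPE('b) TYPE('c) X" "is_basis X \<B>"
  shows "\<exists>N. N \<subseteq> lists \<B> \<and> sieve X N"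
proof -
  obtain Y :: "'b topology" and f where Y: "cech_complete_via TYPE('c) Y"
    and f: "continuous_map Y X f" "open_map Y X f" "f ` topspace Y = topspace X"
    using assms(1) unfolding interpretable_via_def by blast
  obtain K :: "'c topology" and S where K: "compact_space K" "Hausdorff_space K" "gdelta_in K S"
    and "Y homeomorphic_space subtopology K S"
    using Y unfolding cech_complete_via_def by blast
  then obtain h where h: "homeomorphic_map (subtopology K S) Y h"
    using homeomorphic_space homeomorphic_space_sym by blast
  have S: "S \<subseteq> topspace K" using K(3) gdelta_in_subset by blast
  have "h ` S = topspace Y"
    using homeomorphic_imp_surjective_map[OF h] S by (simp add: Int_absorb1)
  then have "(f \<circ> h) ` S = topspace X"
    using f(3) by (metis image_comp)
  moreover have "continuous_map (subtopology K S) X (f \<circ> h)"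
    using h f(1) continuous_map_compose homeomorphic_imp_continuous_map by blast
  moreover have "open_map (subtopology K S) X (f \<circ> h)"
    using h f(2) open_map_compose homeomorphic_imp_open_map by blast
  ultimately show ?thesis
    using sieve_of_open_image_of_gdelta[OF K _ _ _ assms(2)] by blast
qed

section \<open>The space of branches\<close>

lemma openin_pre:
  "openin (product_topology (\<lambda>_. discrete_topology UNIV) UNIV) {\<gamma>. pre \<gamma> n = s}"
proof (cases "\<exists>\<beta>. s = pre \<beta> n")
  case True
  then obtain \<beta> where \<beta>: "s = pre \<beta> n" by blast
  let ?U = "\<lambda>i. if i < n then {\<beta> i} else UNIV"
  have "{\<gamma>. pre \<gamma> n = s} = (\<Pi>\<^sub>E i\<in>UNIV. ?U i)"
    by (auto simp: \<beta> pre_eq_iff PiE_iff split: if_splits)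
  moreover have "finite {i. ?U i \<noteq> UNIV}"
    by (rule finite_subset[of _ "{..<n}"]) auto
  ultimately show ?thesis
    by (simp add: openin_PiE_gen)
next
  case False
  then have "{\<gamma>. pre \<gamma> n = s} = {}" by auto
  then show ?thesis by simp
qed

lemma openin_power_discrete_imp_pre:
  assumes "openin (product_topology (\<lambda>_. discrete_topology UNIV) UNIV) U" "\<beta> \<in> U"
  shows "\<exists>n. {\<gamma>. pre \<gamma> n = pre \<beta> n} \<subseteq> U"
proof -
  obtain T where T: "finite {i. T i \<noteq> UNIV}" "\<beta> \<in> Pi\<^sub>E UNIV T" "Pi\<^sub>E UNIV T \<subseteq> U"
    using bspec[OF assms(1)[unfolded openin_product_topology_alt] assms(2)] by auto
  obtain n where n: "\<And>i. T i \<noteq> UNIV \<Longrightarrow> i < n"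
    using T(1) finite_nat_set_iff_bounded by auto
  have "\<gamma> \<in> Pi\<^sub>E UNIV T" if "pre \<gamma> n = pre \<beta> n" for \<gamma>
  proof (intro PiE_I)
    fix i
    show "\<gamma> i \<in> T i"
      using that n[of i] PiE_mem[OF T(2), of i] by (cases "T i = UNIV") (auto simp: pre_eq_iff)
  qed auto
  then show ?thesis using T(3) by blast
qed

lemma pre_eq_mono: "pre \<beta> n = pre \<gamma> n \<Longrightarrow> m \<le> n \<Longrightarrow> pre \<beta> m = pre \<gamma> m"
  by (simp add: pre_eq_iff)

context sieve
begin

section \<open>Topology, completeness, normality and projection of the branch space\<close>

definition branches :: "((nat \<Rightarrow> 'a set) \<times> 'a) set"
  where "branches = {(\<beta>,x). (\<forall>n. pre \<beta> n \<in> N) \<and> (\<forall>n. x \<in> \<beta> n)}"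

definition branch_space :: "((nat \<Rightarrow> 'a set) \<times> 'a) topology"
  where "branch_space =
    subtopology (prod_topology (product_topology (\<lambda>_. discrete_topology UNIV) UNIV) X) branches"

definition cyl :: "'a set list \<Rightarrow> ((nat \<Rightarrow> 'a set) \<times> 'a) set"
  where "cyl s = {z \<in> branches. pre (fst z) (length s) = s}"

lemma in_cyl_pre: "z \<in> cyl (pre \<beta> n) \<longleftrightarrow> z \<in> branches \<and> pre (fst z) n = pre \<beta> n"
  by (simp add: cyl_def)

lemma cyl_subset: "cyl s \<subseteq> branches"
  by (auto simp: cyl_def)

lemma branch_openin: "(\<And>n. pre \<beta> n \<in> N) \<Longrightarrow> openin X (\<beta> n)"
  using openin_node[of "\<beta> n" "pre \<beta> n"] by (metis pre_Suc)

lemma branchesD: "z \<in> branches \<Longrightarrow> pre (fst z) n \<in> N" "z \<in> branches \<Longrightarrow> snd z \<in> fst z n"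
  by (auto simp: branches_def)

lemma topspace_branch_space [simp]: "topspace branch_space = branches"
proof -
  have "snd z \<in> topspace X" if "z \<in> branches" for z
    using branchesD[OF that] branch_openin[of "fst z" 0] openin_subset by blast
  then show ?thesis
    by (auto simp: branch_space_def)
qed

lemma openin_cyl_Int: "openin X A \<Longrightarrow> openin branch_space (cyl s \<inter> snd -` A)"
  unfolding branch_space_def openin_subtopology
  by (intro exI[of _ "{\<gamma>. pre \<gamma> (length s) = s} \<times> A"])
     (auto simp: cyl_def openin_prod_Times_iff openin_pre)

lemma openin_cyl: "openin branch_space (cyl s)"
proof -
  have "cyl s \<inter> snd -` topspace X = cyl s"
    using openin_subset[OF branch_openin] branchesD unfolding cyl_def by fastforce
  then show ?thesis
    using openin_cyl_Int[of "topspace X" s] by simp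
qed

lemma openin_branch_space_imp_cyl:
  assumes "openin branch_space W" "z \<in> W"
  shows "\<exists>n A. openin X A \<and> snd z \<in> A \<and> cyl (pre (fst z) n) \<inter> snd -` A \<subseteq> W"
proof -
  let ?P = "product_topology (\<lambda>_. discrete_topology UNIV) UNIV :: (nat \<Rightarrow> 'a set) topology"
  obtain T where T: "openin (prod_topology ?P X) T" "W = T \<inter> branches"
    using assms(1) unfolding branch_space_def openin_subtopology by blast
  obtain \<beta> x where z: "z = (\<beta>,x)" by fastforce
  then have "(\<beta>,x) \<in> T" using assms(2) T(2) by blast
  then obtain U A where UA: "openin ?P U" "openin X A" "\<beta> \<in> U" "x \<in> A" "U \<times> A \<subseteq> T"
    using T(1) unfolding openin_prod_topology_alt by metis
  obtain n where "{\<gamma>. pre \<gamma> n = pre \<beta> n} \<subseteq> U"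
    using openin_power_discrete_imp_pre[OF UA(1,3)] by blast
  then have "cyl (pre \<beta> n) \<inter> snd -` A \<subseteq> W"
    using UA(5) T(2) by (fastforce simp: in_cyl_pre)
  then show ?thesis
    using UA(2,4) z by auto
qed

lemma Hausdorff_branch_space: "Hausdorff_space X \<Longrightarrow> Hausdorff_space branch_space"
  unfolding branch_space_def
  by (intro Hausdorff_space_subtopology)
     (simp add: Hausdorff_space_prod_topology Hausdorff_space_product_topology)

lemma regular_branch_space: "regular_space X \<Longrightarrow> regular_space branch_space"
  unfolding branch_space_def
  by (intro regular_space_subtopology)
     (simp add: regular_space_prod_topology regular_space_product_topology)

text \<open>Over a single branch a cover by open sets can be pushed down to \<open>X\<close>: take
  the open \<open>A\<close> whose preimage in some cylinder of the branch lies in one cover member.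
  Completeness of the branch leaves finitely many \<open>A\<close>, and a single deeper cylinder
  works for all of them.\<close>

lemma complete_seq_cyl:
  assumes \<beta>: "\<And>n. pre \<beta> n \<in> N"
  shows "complete_seq branch_space (\<lambda>n. cyl (pre \<beta> n))"
  unfolding complete_seq_def
proof (intro allI impI, elim conjE)
  fix \<U> assume \<U>: "\<forall>U\<in>\<U>. openin branch_space U" "(\<Inter>n. cyl (pre \<beta> n)) \<subseteq> \<Union>\<U>"
  define \<A> where "\<A> = {A. openin X A \<and> (\<exists>m. \<exists>U\<in>\<U>. cyl (pre \<beta> m) \<inter> snd -` A \<subseteq> U)}"
  have "(\<Inter>n. \<beta> n) \<subseteq> \<Union>\<A>"
  proof
    fix x assume x: "x \<in> (\<Inter>n. \<beta> n)"
    then have "(\<beta>,x) \<in> (\<Inter>n. cyl (pre \<beta> n))"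
      using \<beta> by (auto simp: in_cyl_pre branches_def)
    then obtain U where U: "U \<in> \<U>" "(\<beta>,x) \<in> U" using \<U>(2) by blast
    then obtain m A where "openin X A" "x \<in> A" "cyl (pre \<beta> m) \<inter> snd -` A \<subseteq> U"
      using openin_branch_space_imp_cyl[of U "(\<beta>,x)"] \<U>(1) by auto
    then show "x \<in> \<Union>\<A>" using U(1) unfolding \<A>_def by blast
  qed
  moreover have "\<And>A. A \<in> \<A> \<Longrightarrow> openin X A" by (simp add: \<A>_def)
  ultimately obtain n \<F> where \<F>: "finite \<F>" "\<F> \<subseteq> \<A>" "\<beta> n \<subseteq> \<Union>\<F>"
    using complete_seqD[OF complete[OF \<beta>], of \<A>] by metis
  have "\<forall>A\<in>\<F>. \<exists>m U. U \<in> \<U> \<and> cyl (pre \<beta> m) \<inter> snd -` A \<subseteq> U"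
    using \<F>(2) unfolding \<A>_def by blast
  then obtain m U where mU: "\<And>A. A \<in> \<F> \<Longrightarrow> U A \<in> \<U>"
    "\<And>A. A \<in> \<F> \<Longrightarrow> cyl (pre \<beta> (m A)) \<inter> snd -` A \<subseteq> U A"
    by metis
  \<comment> \<open>Level \<open>Suc n\<close> fixes the entry with index \<open>n\<close>, which
    forces the second component into \<open>\<beta> n\<close>; the other levels make each chosen
    \<open>A\<close> usable.\<close>
  define k where "k = Max (insert (Suc n) (m ` \<F>))"
  have k: "Suc n \<le> k" "\<And>A. A \<in> \<F> \<Longrightarrow> m A \<le> k"
    using \<F>(1) by (auto simp: k_def)
  have "cyl (pre \<beta> k) \<subseteq> \<Union>(U ` \<F>)"
  proof
    fix z assume z: "z \<in> cyl (pre \<beta> k)"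
    then have zb: "z \<in> branches" "pre (fst z) k = pre \<beta> k" by (auto simp: in_cyl_pre)
    then have "fst z n = \<beta> n" using k(1) by (simp add: pre_eq_iff)
    then obtain A where A: "A \<in> \<F>" "snd z \<in> A" using \<F>(3) branchesD(2)[OF zb(1), of n] by auto
    have "z \<in> cyl (pre \<beta> (m A))"
      using zb k(2)[OF A(1)] by (auto simp: in_cyl_pre intro: pre_eq_mono)
    then show "z \<in> \<Union>(U ` \<F>)" using mU(2)[OF A(1)] A by blast
  qed
  moreover have "finite (U ` \<F>)" "U ` \<F> \<subseteq> \<U>" using \<F>(1) mU(1) by auto
  ultimately show "\<exists>n \<V>. finite \<V> \<and> \<V> \<subseteq> \<U> \<and> cyl (pre \<beta> n) \<subseteq> \<Union>\<V>" by blast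
qed

text \<open>The points sharing a branch form a compact set with the cylinders as a neighbourhood
  base. Regularity therefore separates \<open>P\<close> and \<open>Q\<close> inside some cylinder
  around each branch, and the local separations are glued along disjoint cylinders.\<close>

lemma normal_branch_space:
  assumes "regular_space X"
  shows "normal_space branch_space"
  unfolding normal_space_def
proof (intro allI impI, elim conjE)
  fix P Q assume PQ: "closedin branch_space P" "closedin branch_space Q" "disjnt P Q"
  let ?sep = "\<lambda>s U V. openin branch_space U \<and> openin branch_space V \<and> disjnt U V \<and>
      P \<inter> cyl s \<subseteq> U \<and> Q \<inter> cyl s \<subseteq> V"
  define Sep where "Sep s \<longleftrightarrow> (\<exists>U V. ?sep s U V)" for s
  have reg: "\<exists>W. openin branch_space W \<and> z \<in> W \<and> disjnt C (branch_space closure_of W)"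
    if "closedin branch_space C" "z \<in> branches" "z \<notin> C" for C z
    using regular_branch_space[OF assms] that
    unfolding regular_space topspace_branch_space by blast
  have ev_Sep: "\<exists>n. Sep (pre (fst z) n)" if z: "z \<in> branches" for z
  proof -
    define \<U> where "\<U> = {W. openin branch_space W \<and>
      (disjnt P (branch_space closure_of W) \<or> disjnt Q (branch_space closure_of W))}"
    have "branches \<subseteq> \<Union>\<U>"
    proof
      fix w assume w: "w \<in> branches"
      then have "w \<notin> P \<or> w \<notin> Q" using PQ(3) unfolding disjnt_def by blast
      then show "w \<in> \<Union>\<U>" using reg[OF PQ(1) w] reg[OF PQ(2) w] unfolding \<U>_def by blast
    qed
    then have "(\<Inter>n. cyl (pre (fst z) n)) \<subseteq> \<Union>\<U>" using cyl_subset by blast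
    moreover have "\<And>W. W \<in> \<U> \<Longrightarrow> openin branch_space W" by (simp add: \<U>_def)
    ultimately obtain n \<V> where \<V>: "finite \<V>" "\<V> \<subseteq> \<U>" "cyl (pre (fst z) n) \<subseteq> \<Union>\<V>"
      using complete_seqD[OF complete_seq_cyl[OF branchesD(1)[OF z]], of \<U>] by metis
    \<comment> \<open>Only finitely many closures missing \<open>C\<close> are removed, so
      \<open>far C\<close> is open and contains the points of \<open>C\<close>. Each point of the
      cylinder lies in a \<open>W\<close> whose closure was removed from \<open>far P\<close> or
      from \<open>far Q\<close>.\<close>
    define far where "far C = branches - (\<Union>W \<in> {W \<in> \<V>. disjnt C (branch_space closure_of W)}. branch_space closure_of W)" for C
    have far_open: "openin branch_space (far C)" for C
      unfolding far_def topspace_branch_space[symmetric] using \<V>(1)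
      by (intro openin_diff openin_topspace closedin_Union) auto
    have far_sub: "C \<inter> cyl (pre (fst z) n) \<subseteq> far C \<inter> cyl (pre (fst z) n)" for C
      using cyl_subset unfolding far_def disjnt_def by blast
    have "disjnt (far P \<inter> cyl (pre (fst z) n)) (far Q \<inter> cyl (pre (fst z) n))"
      unfolding disjnt_iff
    proof (intro allI notI, elim conjE IntE)
      fix w assume w: "w \<in> far P" "w \<in> far Q" "w \<in> cyl (pre (fst z) n)"
      then obtain W where W: "W \<in> \<V>" "w \<in> W" using \<V>(3) by blast
      then have "openin branch_space W" using \<V>(2) by (auto simp: \<U>_def)
      then have "w \<in> branch_space closure_of W"
        using W(2) closure_of_subset[OF openin_subset] by blast
      moreover have "disjnt P (branch_space closure_of W) \<or> disjnt Q (branch_space closure_of W)"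
        using W(1) \<V>(2) unfolding \<U>_def by blast
      ultimately show False using w(1,2) W(1) unfolding far_def by blast
    qed
    then have "?sep (pre (fst z) n) (far P \<inter> cyl (pre (fst z) n)) (far Q \<inter> cyl (pre (fst z) n))"
      by (intro conjI openin_Int far_open openin_cyl far_sub)
    then show ?thesis unfolding Sep_def by blast
  qed
  have "\<exists>U V. Sep s \<longrightarrow> ?sep s U V" for s
    unfolding Sep_def by blast
  then obtain U V where UV: "\<And>s. Sep s \<Longrightarrow> ?sep s (U s) (V s)"
    by metis
  \<comment> \<open>The shortest separated prefixes index a partition into clopen cylinders.\<close>
  define k where "k z = (LEAST n. Sep (pre (fst z) n))" for z :: "(nat \<Rightarrow> 'a set) \<times> 'a"
  define r where "r z = pre (fst z) (k z)" for z :: "(nat \<Rightarrow> 'a set) \<times> 'a"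
  have Sep_r: "Sep (r z)" if "z \<in> branches" for z
    unfolding r_def k_def by (rule LeastI_ex[OF ev_Sep[OF that]])
  \<comment> \<open>Separation depends only on the prefix, so points that agree up to level
    \<open>k z\<close> have the same least separated level.\<close>
  have r_eq: "r w = r z" if "z \<in> branches" "w \<in> cyl (r z)" for w z
  proof -
    have w: "pre (fst w) m = pre (fst z) m" if "m \<le> k z" for m
      using \<open>w \<in> cyl (r z)\<close> that unfolding r_def in_cyl_pre by (meson pre_eq_mono)
    have "k w = k z"
      unfolding k_def[of w]
    proof (rule Least_equality)
      show "Sep (pre (fst w) (k z))" using Sep_r[OF that(1)] w by (simp add: r_def)
      show "k z \<le> m" if "Sep (pre (fst w) m)" for m
      proof (rule ccontr)
        assume "\<not> k z \<le> m"
        then have "Sep (pre (fst z) m)" using w that by simp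
        then have "k z \<le> m" unfolding k_def by (rule Least_le)
        then show False using \<open>\<not> k z \<le> m\<close> by simp
      qed
    qed
    then show ?thesis using w by (simp add: r_def)
  qed
  have cyl_r: "z \<in> cyl (r z)" if "z \<in> branches" for z
    using that by (simp add: r_def in_cyl_pre)
  \<comment> \<open>The prefix \<open>r\<close> is constant on the open cylinder
    \<open>cyl (r z)\<close>, so there membership in the glued set amounts to membership in the
    single open set \<open>F (r z)\<close>.\<close>
  have open_glue: "openin branch_space {z \<in> branches. z \<in> F (r z)}"
    if F: "\<And>s. Sep s \<Longrightarrow> openin branch_space (F s)" for F
  proof (subst openin_subopen, intro ballI)
    fix z assume "z \<in> {z \<in> branches. z \<in> F (r z)}"
    then have z: "z \<in> branches" "z \<in> F (r z)" by auto
    have "openin branch_space (F (r z) \<inter> cyl (r z))"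
      using F[OF Sep_r[OF z(1)]] openin_cyl by blast
    moreover have "F (r z) \<inter> cyl (r z) \<subseteq> {z \<in> branches. z \<in> F (r z)}"
      using r_eq[OF z(1)] cyl_subset by auto
    ultimately show "\<exists>T. openin branch_space T \<and> z \<in> T \<and> T \<subseteq> {z \<in> branches. z \<in> F (r z)}"
      using z cyl_r by blast
  qed
  let ?U = "{z \<in> branches. z \<in> U (r z)}" and ?V = "{z \<in> branches. z \<in> V (r z)}"
  have "openin branch_space ?U" "openin branch_space ?V"
    using UV by (intro open_glue; simp)+
  moreover have "z \<in> U (r z)" if "z \<in> P" for z
  proof -
    have z: "z \<in> branches" using that closedin_subset[OF PQ(1)] by auto
    with UV[OF Sep_r[OF z]] cyl_r that show ?thesis by blast
  qed
  moreover have "z \<in> V (r z)" if "z \<in> Q" for z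
  proof -
    have z: "z \<in> branches" using that closedin_subset[OF PQ(2)] by auto
    with UV[OF Sep_r[OF z]] cyl_r that show ?thesis by blast
  qed
  moreover have "P \<subseteq> branches" "Q \<subseteq> branches"
    using PQ(1,2)[THEN closedin_subset] by simp_all
  moreover have "disjnt ?U ?V"
  proof -
    have "z \<notin> V (r z)" if "z \<in> branches" "z \<in> U (r z)" for z
      using UV[OF Sep_r[OF that(1)]] that(2) unfolding disjnt_def by blast
    then show ?thesis unfolding disjnt_def by blast
  qed
  ultimately show "\<exists>U V. openin branch_space U \<and> openin branch_space V \<and> P \<subseteq> U \<and> Q \<subseteq> V \<and> disjnt U V"
    by blast
qed

text \<open>Basic neighbourhoods are coded by a finite prefix with entries in \<open>\<B>\<close>
  and one member of \<open>\<B>\<close>; an infinite \<open>\<B>\<close> absorbs both the lists and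
  the product.\<close>

lemma branch_space_basis:
  assumes "is_basis X \<B>" "N \<subseteq> lists \<B>" "infinite \<B>"
  shows "\<exists>\<C>. is_basis branch_space \<C> \<and> \<C> \<lesssim> \<B>"
proof -
  let ?C = "(\<lambda>(s,B). cyl s \<inter> snd -` B) ` (lists \<B> \<times> \<B>)"
  have "\<exists>V\<in>?C. z \<in> V \<and> V \<subseteq> W" if W: "openin branch_space W" "z \<in> W" for W z
  proof -
    obtain n A where A: "openin X A" "snd z \<in> A" "cyl (pre (fst z) n) \<inter> snd -` A \<subseteq> W"
      using openin_branch_space_imp_cyl[OF W] by blast
    then obtain B where B: "B \<in> \<B>" "snd z \<in> B" "B \<subseteq> A"
      using assms(1) unfolding is_basis_def by meson
    have z: "z \<in> branches" using W openin_subset by fastforce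
    then have "(pre (fst z) n, B) \<in> lists \<B> \<times> \<B>"
      using B(1) branchesD(1) assms(2) by blast
    moreover have "z \<in> cyl (pre (fst z) n) \<inter> snd -` B"
      using z B(2) by (simp add: in_cyl_pre)
    moreover have "cyl (pre (fst z) n) \<inter> snd -` B \<subseteq> W"
      using A(3) B(3) by blast
    ultimately show ?thesis by (intro bexI[of _ "cyl (pre (fst z) n) \<inter> snd -` B"]) auto
  qed
  moreover have "openin branch_space V" if "V \<in> ?C" for V
    using that assms(1) openin_cyl_Int by (auto simp: is_basis_def)
  ultimately have "is_basis branch_space ?C"
    unfolding is_basis_def by blast
  moreover have "?C \<lesssim> \<B>"
    using times_lepoll_infinite[OF assms(3) lists_lepoll_infinite[OF assms(3)], of \<B>]
    by (meson image_lepoll lepoll_trans lepoll_refl)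
  ultimately show ?thesis by blast
qed

lemma continuous_map_branch_space_snd: "continuous_map branch_space X snd"
  unfolding branch_space_def
  by (intro continuous_map_from_subtopology continuous_map_snd)

text \<open>Around the projection of a point, take \<open>A\<close> and the first \<open>n\<close>
  entries of its branch. Every \<open>y\<close> in their intersection extends the same prefix to a
  branch of its own, so it is attained in the given basic neighbourhood.\<close>

lemma open_map_branch_space_snd: "open_map branch_space X snd"
  unfolding open_map_def
proof (intro allI impI)
  fix W assume W: "openin branch_space W"
  show "openin X (snd ` W)"
  proof (subst openin_subopen, intro ballI)
    fix x assume "x \<in> snd ` W"
    then obtain z where z: "z \<in> W" "x = snd z" by blast
    obtain n A where A: "openin X A" "snd z \<in> A" "cyl (pre (fst z) n) \<inter> snd -` A \<subseteq> W"
      using openin_branch_space_imp_cyl[OF W z(1)] by blast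
    have zb: "z \<in> branches" using W z(1) openin_subset by fastforce
    let ?T = "\<Inter>(insert A (fst z ` {..<n}))"
    have "openin X ?T"
      using A(1) branch_openin[OF branchesD(1)[OF zb]] by (intro openin_Inter) auto
    moreover have "x \<in> ?T"
      using A(2) z(2) branchesD(2)[OF zb] by auto
    moreover have "?T \<subseteq> snd ` W"
    proof
      fix y assume y: "y \<in> ?T"
      then have "y \<in> topspace X" using A(1) openin_subset by blast
      then obtain \<gamma> where "pre \<gamma> n = pre (fst z) n" "\<And>m. pre \<gamma> m \<in> N" "\<And>i. y \<in> \<gamma> i"
        using extend_to_branch[of n "fst z" y] branchesD(1)[OF zb] y by blast
      then have "(\<gamma>, y) \<in> cyl (pre (fst z) n) \<inter> snd -` A"
        using y by (simp add: in_cyl_pre branches_def)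
      then show "y \<in> snd ` W" using A(3) by force
    qed
    ultimately show "\<exists>T. openin X T \<and> x \<in> T \<and> T \<subseteq> snd ` W" by blast
  qed
qed

lemma snd_image_branches: "snd ` branches = topspace X"
proof
  show "snd ` branches \<subseteq> topspace X"
    using continuous_map_image_subset_topspace[OF continuous_map_branch_space_snd] by simp
  show "topspace X \<subseteq> snd ` branches"
  proof
    fix y assume "y \<in> topspace X"
    then obtain \<gamma> :: "nat \<Rightarrow> 'a set" where "\<And>m. pre \<gamma> m \<in> N" "\<And>i. y \<in> \<gamma> i"
      \<comment> \<open>The extension starts at the root, so an arbitrary sequence may stand for the
        empty prefix.\<close>
      using extend_to_branch[of 0 undefined y] Nil_node by auto
    then have "(\<gamma>, y) \<in> branches" by (simp add: branches_def)
    then show "y \<in> snd ` branches" by force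
  qed
qed

end

section \<open>Compactification and metrization\<close>

lemma embedding_map_in_closure:
  assumes "embedding_map X P e"
  defines "Z \<equiv> subtopology P (P closure_of (e ` topspace X))"
  shows "embedding_map X Z e" "Z closure_of (e ` topspace X) = topspace Z"
proof -
  have S: "e ` topspace X \<subseteq> topspace P"
    using assms(1) unfolding embedding_map_def
    by (metis homeomorphic_imp_surjective_map inf_le1 topspace_subtopology)
  then have S': "e ` topspace X \<subseteq> P closure_of (e ` topspace X)"
    by (rule closure_of_subset)
  then show "embedding_map X Z e"
    using assms(1) unfolding Z_def embedding_map_in_subtopology by blast
  show "Z closure_of (e ` topspace X) = topspace Z"
    unfolding Z_def closure_of_subtopology topspace_subtopology
    using S' closure_of_subset_topspace[of P "e ` topspace X"] by (simp add: Int_absorb1)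
qed

lemma embedding_map_open_trace:
  assumes "embedding_map X Z e" "openin X U"
  shows "\<exists>G. openin Z G \<and> G \<inter> e ` topspace X = e ` U"
proof -
  have "openin (subtopology Z (e ` topspace X)) (e ` U)"
    using assms homeomorphic_imp_open_map unfolding embedding_map_def open_map_def by blast
  then show ?thesis unfolding openin_subtopology by metis
qed

lemma embedding_map_imp_continuous: "embedding_map X Z e \<Longrightarrow> continuous_map X Z e"
  unfolding embedding_map_def
  by (metis continuous_map_in_subtopology homeomorphic_imp_continuous_map)

lemma embedding_map_imp_inj_on: "embedding_map X Z e \<Longrightarrow> inj_on e (topspace X)"
  unfolding embedding_map_def by (rule homeomorphic_imp_injective_map)

text \<open>Precomposing with the inverse of the embedding carries an open map over to the image
  inside \<open>Z\<close>.\<close>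

lemma embedding_map_inverse:
  assumes e: "embedding_map X Z e" and f: "continuous_map X Y f" "open_map X Y f"
  defines "S \<equiv> e ` topspace X"
  shows "\<exists>g. continuous_map (subtopology Z S) Y g \<and> open_map (subtopology Z S) Y g \<and>
    g ` S = f ` topspace X"
proof -
  obtain h where h: "homeomorphic_maps X (subtopology Z S) e h"
    using e unfolding embedding_map_def homeomorphic_map_maps S_def by blast
  then have hm: "homeomorphic_map (subtopology Z S) X h"
    using homeomorphic_maps_map by blast
  have "continuous_map (subtopology Z S) Y (f \<circ> h)"
    by (rule continuous_map_compose[OF homeomorphic_imp_continuous_map[OF hm] f(1)])
  moreover have "open_map (subtopology Z S) Y (f \<circ> h)"
    by (rule open_map_compose[OF homeomorphic_imp_open_map[OF hm] f(2)])
  moreover have "(f \<circ> h) ` S = f ` topspace X"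
  proof -
    have "\<And>x. x \<in> topspace X \<Longrightarrow> h (e x) = x"
      using h unfolding homeomorphic_maps_def by blast
    then show ?thesis unfolding S_def image_image comp_def by (intro image_cong) auto
  qed
  ultimately show ?thesis by blast
qed

section \<open>G-delta images under dense embeddings\<close>

context sieve
begin

text \<open>The image is the intersection of the open sets \<open>C n\<close>, each a union of open
  extensions of level \<open>n\<close> cylinders. A point in all of them selects a prefix at every
  level; density makes the prefixes cohere into a branch, and completeness places the point in the
  image.\<close>

lemma gdelta_in_branch_space_image:
  assumes Z: "Hausdorff_space Z" and e: "embedding_map branch_space Z e"
    and dense: "Z closure_of (e ` branches) = topspace Z"
  shows "gdelta_in Z (e ` branches)"
proof -
  have cont: "continuous_map branch_space Z e" using e by (rule embedding_map_imp_continuous)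
  have inj: "inj_on e branches" using embedding_map_imp_inj_on[OF e] by simp
  have "\<exists>G. openin Z G \<and> G \<inter> e ` branches = e ` cyl s" for s
    using embedding_map_open_trace[OF e openin_cyl] by simp
  then obtain G where G: "\<And>s. openin Z (G s)" "\<And>s. G s \<inter> e ` branches = e ` cyl s"
    by metis
  define C where "C n = (\<Union>z\<in>branches. G (pre (fst z) n))" for n
  have "e z \<in> G (pre (fst z) n)" if "z \<in> branches" for z n
    using G(2)[of "pre (fst z) n"] that in_cyl_pre[of z "fst z" n] by blast
  then have "e ` branches \<subseteq> (\<Inter>n. C n)"
    unfolding C_def by blast
  moreover have "(\<Inter>n. C n) \<subseteq> e ` branches"
  proof
    fix p assume "p \<in> (\<Inter>n. C n)"
    then have "\<exists>z. z \<in> branches \<and> p \<in> G (pre (fst z) n)" for n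
      unfolding C_def by blast
    then obtain z where z: "\<And>n. z n \<in> branches" "\<And>n. p \<in> G (pre (fst (z n)) n)"
      by metis
    \<comment> \<open>By density the cylinders selected at the various levels are nested.\<close>
    have coherent: "pre (fst (z n)) m = pre (fst (z m)) m" if "m \<le> n" for m n
    proof -
      have "openin Z (G (pre (fst (z m)) m) \<inter> G (pre (fst (z n)) n))"
        using G(1) by blast
      then have "e ` branches \<inter> (G (pre (fst (z m)) m) \<inter> G (pre (fst (z n)) n)) \<noteq> {}"
        using dense z(2) unfolding dense_intersects_open by blast
      then obtain y where y: "y \<in> branches" "e y \<in> G (pre (fst (z m)) m)" "e y \<in> G (pre (fst (z n)) n)"
        by blast
      then have "e y \<in> e ` cyl (pre (fst (z m)) m)" "e y \<in> e ` cyl (pre (fst (z n)) n)"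
        using G(2) by blast+
      then have "y \<in> cyl (pre (fst (z m)) m)" "y \<in> cyl (pre (fst (z n)) n)"
        using inj_on_image_mem_iff[OF inj y(1) cyl_subset] by blast+
      then show ?thesis
        using pre_eq_mono[OF _ that] unfolding in_cyl_pre by metis
    qed
    \<comment> \<open>Entry \<open>i\<close> first appears in the prefix of length
      \<open>Suc i\<close>, so it is read from the selection at that level.\<close>
    define \<beta> where "\<beta> i = fst (z (Suc i)) i" for i
    have \<beta>: "pre \<beta> n = pre (fst (z n)) n" for n
      unfolding pre_eq_iff
    proof (intro allI impI)
      fix i assume "i < n"
      then have "pre (fst (z n)) (Suc i) = pre (fst (z (Suc i))) (Suc i)"
        by (intro coherent) simp
      then show "\<beta> i = fst (z n) i" by (simp add: \<beta>_def)
    qed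
    then have "\<And>n. pre \<beta> n \<in> N" using branchesD(1)[OF z(1)] by simp
    then have "complete_seq branch_space (\<lambda>n. cyl (pre \<beta> n))"
      by (rule complete_seq_cyl)
    moreover have "cyl (pre \<beta> n) \<subseteq> topspace branch_space" for n
      using cyl_subset by simp
    moreover have "G (pre \<beta> n) \<inter> e ` topspace branch_space \<subseteq> e ` cyl (pre \<beta> n)" for n
      using G(2) by simp
    moreover have "p \<in> G (pre \<beta> n)" for n
      using z(2) \<beta> by simp
    ultimately have "p \<in> e ` (\<Inter>n. cyl (pre \<beta> n))"
      using complete_seq_limit_in_image[OF Z cont, of "\<lambda>n. cyl (pre \<beta> n)" "\<lambda>n. G (pre \<beta> n)" p]
        dense G(1) by simp
    then show "p \<in> e ` branches"
      using cyl_subset by blast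
  qed
  ultimately have eq: "e ` branches = \<Inter>(range C)" by blast
  have "openin Z (C n)" for n
    unfolding C_def using G(1) by blast
  then have "gdelta_in Z (\<Inter>(range C))"
    by (intro gdelta_in_Inter) (auto intro: open_imp_gdelta_in)
  then show ?thesis unfolding eq .
qed

text \<open>Following at each node the first child that contains a given point, one either runs into
  a node without such a child, or obtains a branch, whose completeness puts the point into the
  image of \<open>X\<close>. The set of points that get stuck at a given node is a difference of
  F-sigma and open sets.\<close>

lemma gdelta_in_image_if_countable:
  assumes Z: "metrizable_space Z" and e: "embedding_map X Z e"
    and dense: "Z closure_of (e ` topspace X) = topspace Z"
    and \<B>: "countable \<B>" "\<And>b. b \<in> \<B> \<Longrightarrow> openin X b" "N \<subseteq> lists \<B>"
  shows "gdelta_in Z (e ` topspace X)"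
proof -
  have cont: "continuous_map X Z e" using e by (rule embedding_map_imp_continuous)
  have inj: "inj_on e (topspace X)" using e by (rule embedding_map_imp_inj_on)
  have "\<exists>G. b \<in> \<B> \<longrightarrow> openin Z G \<and> G \<inter> e ` topspace X = e ` b" for b
    using embedding_map_open_trace[OF e \<B>(2)] by blast
  then obtain G where G: "\<And>b. b \<in> \<B> \<Longrightarrow> openin Z (G b)"
    "\<And>b. b \<in> \<B> \<Longrightarrow> G b \<inter> e ` topspace X = e ` b"
    by metis
  have node: "b \<in> \<B>" if "b # s \<in> N" for b s
    using that \<B>(3) by auto
  define idx where "idx = to_nat_on \<B>"
  define E where "E s b = (\<Union>b' \<in> {b'. b' # s \<in> N \<and> idx b' < idx b}. G b')" for s b
  \<comment> \<open>\<open>Q s\<close> collects the points for which \<open>s\<close> arises by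
    always taking the first child, in the enumeration \<open>idx\<close>, whose open set
    \<open>G b\<close> contains the point.\<close>
  define Q where "Q = rec_list (topspace Z) (\<lambda>b s R. R \<inter> (G b - E s b))"
  have Q_Nil: "Q [] = topspace Z" and Q_Cons: "Q (b # s) = Q s \<inter> (G b - E s b)" for b s
    by (auto simp: Q_def)
  \<comment> \<open>For a node \<open>s\<close>, these are the points that reach \<open>s\<close>
    and then get stuck there.\<close>
  define F where "F s = Q s - (\<Union>b \<in> {b. b # s \<in> N}. G b)" for s
  have fsigma_Q: "fsigma_in Z (Q s)" if "s \<in> lists \<B>" for s
    using that
  proof (induction s)
    case (Cons b s)
    have "openin Z (E s b)"
      unfolding E_def using G(1) node by blast
    moreover have "openin Z (G b)"
      using Cons G(1) by simp
    ultimately have "fsigma_in Z (G b - E s b)"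
      using Z by (intro fsigma_in_diff open_imp_fsigma_in open_imp_gdelta_in)
    then show ?case
      using Cons unfolding Q_Cons by (intro fsigma_in_Int) auto
  qed (simp add: Q_Nil)
  have "fsigma_in Z (F s)" if "s \<in> N" for s
  proof -
    have "openin Z (\<Union>b \<in> {b. b # s \<in> N}. G b)"
      using G(1) node by blast
    moreover have "fsigma_in Z (Q s)"
      using fsigma_Q that \<B>(3) by blast
    ultimately show ?thesis
      unfolding F_def by (intro fsigma_in_diff open_imp_gdelta_in)
  qed
  moreover have "countable N"
    using countable_subset[OF \<B>(3)] \<B>(1) by simp
  ultimately have fsigma: "fsigma_in Z (\<Union>(F ` N))"
    by (intro fsigma_in_Union) auto
  have "topspace Z - e ` topspace X \<subseteq> \<Union>(F ` N)"
  proof (rule ccontr)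
    assume "\<not> ?thesis"
    then obtain p where p: "p \<in> topspace Z" "p \<notin> e ` topspace X" "p \<notin> \<Union>(F ` N)"
      by blast
    have step: "\<exists>b. (b # s \<in> N \<and> p \<in> Q (b # s)) \<and> p \<in> G b" if s: "s \<in> N \<and> p \<in> Q s" for s
    proof -
      let ?ch = "\<lambda>b. b # s \<in> N \<and> p \<in> G b"
      have "\<exists>b. ?ch b"
        using p(3) s unfolding F_def by blast
      then obtain b where b: "?ch b" "\<And>b'. ?ch b' \<Longrightarrow> idx b \<le> idx b'"
        using ex_has_least_nat[of ?ch _ idx] by blast
      then have "p \<notin> E s b"
        unfolding E_def using leD by blast
      then show ?thesis using b(1) s by (auto simp: Q_Cons)
    qed
    have "pre undefined 0 \<in> N \<and> p \<in> Q (pre undefined 0)"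
      using Nil_node p(1) by (simp add: Q_Nil)
    from dependent_list_choice[where P = "\<lambda>s. s \<in> N \<and> p \<in> Q s" and R = "\<lambda>b. p \<in> G b", OF this step]
    obtain \<beta> where \<beta>: "\<And>n. pre \<beta> n \<in> N" "\<And>n. p \<in> G (\<beta> n)"
      by auto
    have \<beta>_mem: "\<beta> n \<in> \<B>" for n
      using \<beta>(1)[of "Suc n"] node by simp
    have "p \<in> e ` (\<Inter>n. \<beta> n)"
    proof (rule complete_seq_limit_in_image[OF metrizable_imp_Hausdorff_space[OF Z] cont dense])
      show "complete_seq X \<beta>" using \<beta>(1) by (rule complete)
      show "\<beta> n \<subseteq> topspace X" for n using \<beta>_mem \<B>(2) openin_subset by blast
      show "openin Z (G (\<beta> n))" "G (\<beta> n) \<inter> e ` topspace X \<subseteq> e ` \<beta> n" for n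
        using G \<beta>_mem by auto
    qed (use \<beta>(2) in auto)
    moreover have "(\<Inter>n. \<beta> n) \<subseteq> topspace X"
      using openin_subset[OF \<B>(2)[OF \<beta>_mem[of 0]]] by blast
    ultimately show False using p(2) by blast
  qed
  \<comment> \<open>If \<open>e x\<close> reaches a node, injectivity of \<open>e\<close> puts
    \<open>x\<close> into its latest entry. Some child then contains \<open>x\<close>, so
    \<open>e x\<close> cannot be stuck.\<close>
  moreover have "e x \<notin> F s" if x: "x \<in> topspace X" and s: "s \<in> N" for x s
  proof
    assume "e x \<in> F s"
    then have Q: "e x \<in> Q s" and no: "\<And>b. b # s \<in> N \<Longrightarrow> e x \<notin> G b"
      unfolding F_def by auto
    have "x \<in> hd (s @ [topspace X])"
    proof (cases s)
      case (Cons b t)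
      then have b: "b \<in> \<B>" using s node by blast
      have "e x \<in> G b" using Q Cons Q_Cons by simp
      then have "e x \<in> e ` b" using G(2)[OF b] x by blast
      then have "x \<in> b"
        using inj_on_image_mem_iff[OF inj x openin_subset[OF \<B>(2)[OF b]]] by blast
      then show ?thesis using Cons by simp
    qed (use x in simp)
    then obtain b where b: "b # s \<in> N" "x \<in> b"
      using child[OF s] by blast
    then have "e x \<in> G b" using G(2)[OF node[OF b(1)]] by blast
    then show False using no[OF b(1)] by blast
  qed
  moreover have "\<Union>(F ` N) \<subseteq> topspace Z"
    using fsigma_in_subset[OF fsigma] .
  ultimately have "topspace Z - e ` topspace X = \<Union>(F ` N)"
    by blast
  moreover have "e ` topspace X \<subseteq> topspace Z"
    using continuous_map_image_subset_topspace[OF cont] .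
  ultimately show ?thesis
    using fsigma unfolding gdelta_in_fsigma_in by simp
qed

end

section \<open>Polishness and covers of small weight\<close>

lemma Polish_space_if_sieve:
  assumes "sieve X N" "N \<subseteq> lists \<B>" "is_basis X \<B>" "countable \<B>"
    and X: "regular_space X" "Hausdorff_space X"
  shows "Polish_space X"
proof -
  interpret sieve X N by fact
  have sc: "second_countable X"
    using assms second_countable_iff_basis by blast
  \<comment> \<open>Second countability supplies the Lindelof property, which upgrades regularity to
    normality and so gives the functions needed for an embedding into a cube.\<close>
  then have "normal_space X"
    using X(1) regular_Lindelof_imp_normal_space second_countable_imp_Lindelof_space by blast
  then have cr: "completely_regular_space X"
    using X normal_imp_completely_regular_space by blast
  let ?P = "product_topology (\<lambda>_. top_of_set {0..1::real}) (\<B> \<times> \<B>)"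
  obtain e where e: "embedding_map X ?P e"
    using embedding_map_cube_basis[OF cr X(2) assms(3) lepoll_refl] by blast
  define Z where "Z = subtopology ?P (?P closure_of (e ` topspace X))"
  have emb: "embedding_map X Z e" and dense: "Z closure_of (e ` topspace X) = topspace Z"
    unfolding Z_def by (rule embedding_map_in_closure[OF e])+
  have "completely_metrizable_space (top_of_set {0..1::real})"
    by (intro completely_metrizable_space_closedin completely_metrizable_space_euclidean) simp
  moreover have "countable {i \<in> \<B> \<times> \<B>. \<not> (\<exists>a. topspace (top_of_set {0..1::real}) \<subseteq> {a})}"
    using assms(4) by (intro countable_subset[OF Collect_restrict]) simp
  ultimately have "completely_metrizable_space ?P"
    unfolding completely_metrizable_space_product_topology by blast
  then have Z: "completely_metrizable_space Z"
    unfolding Z_def by (intro completely_metrizable_space_closedin) auto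
  have "gdelta_in Z (e ` topspace X)"
    using gdelta_in_image_if_countable[OF completely_metrizable_imp_metrizable_space[OF Z] emb dense
        assms(4) _ assms(2)] assms(3) by (auto simp: is_basis_def)
  then have "completely_metrizable_space (subtopology Z (e ` topspace X))"
    by (rule completely_metrizable_space_gdelta_in[OF Z])
  then have "completely_metrizable_space X"
    using homeomorphic_completely_metrizable_space[OF embedding_map_imp_homeomorphic_space[OF emb]] by blast
  then show ?thesis
    unfolding Polish_space_def using second_countable_imp_separable_space[OF sc] by blast
qed

text \<open>The type of \<open>Z\<close> is that of a cube whose coordinates are indexed by members
  of a basis of \<open>X\<close>.\<close>

definition small_gdelta_cover :: "'a topology \<Rightarrow> ('a set \<Rightarrow> real) topology \<Rightarrow> bool"
  where "small_gdelta_cover X Z \<longleftrightarrow> compact_space Z \<and> Hausdorff_space Z \<and> weight_le Z X \<and>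
    (\<exists>S g. gdelta_in Z S \<and> continuous_map (subtopology Z S) X g \<and>
      open_map (subtopology Z S) X g \<and> g ` S = topspace X)"

text \<open>The branch space has a basis no larger than \<open>\<B>\<close>, and pairs of its
  members are no more numerous, so it embeds into the cube indexed by \<open>\<B>\<close> itself.
  The closure of the image inherits the weight bound, and minimality of \<open>\<B>\<close> compares
  it with every basis of \<open>X\<close>.\<close>

lemma small_gdelta_cover_if_infinite_basis:
  assumes "sieve X N" "N \<subseteq> lists \<B>" "is_basis X \<B>" "infinite \<B>"
    and X: "regular_space X" "Hausdorff_space X"
    and minimal: "\<And>\<C>. is_basis X \<C> \<Longrightarrow> \<B> \<lesssim> \<C>"
  shows "\<exists>Z. small_gdelta_cover X Z"
proof -
  interpret sieve X N by fact
  obtain \<C> where \<C>: "is_basis branch_space \<C>" "\<C> \<lesssim> \<B>"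
    using branch_space_basis[OF assms(3,2,4)] by blast
  have cr: "completely_regular_space branch_space"
    using normal_branch_space[OF X(1)] Hausdorff_branch_space[OF X(2)]
    by (simp add: normal_imp_completely_regular_space)
  let ?P = "product_topology (\<lambda>_. top_of_set {0..1::real}) \<B>"
  obtain e where e: "embedding_map branch_space ?P e"
    using embedding_map_cube_basis[OF cr Hausdorff_branch_space[OF X(2)] \<C>(1)
        times_lepoll_infinite[OF assms(4) \<C>(2) \<C>(2)]] by blast
  define Z where "Z = subtopology ?P (?P closure_of (e ` branches))"
  have emb: "embedding_map branch_space Z e" and dense: "Z closure_of (e ` branches) = topspace Z"
    using embedding_map_in_closure[OF e] by (simp_all add: Z_def)
  have "compact_space ?P"
    by (simp add: compact_space_product_topology compact_space_subtopology)
  then have "compact_space Z"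
    unfolding Z_def by (intro compact_space_subtopology closedin_compact_space) auto
  moreover have H: "Hausdorff_space Z"
    unfolding Z_def
    by (intro Hausdorff_space_subtopology)
       (simp add: Hausdorff_space_product_topology Hausdorff_space_subtopology)
  moreover have "weight_le Z X"
  proof -
    obtain \<D> where \<D>: "is_basis ?P \<D>" "\<D> \<lesssim> \<B>"
      using power_topology_basis[OF assms(4) second_countable_real_unit_interval] by blast
    show ?thesis
    proof (rule weight_le_if_minimal[OF minimal])
      show "is_basis Z ((\<lambda>B. (?P closure_of (e ` branches)) \<inter> B) ` \<D>)"
        unfolding Z_def by (rule is_basis_subtopology[OF \<D>(1)])
      show "(\<lambda>B. (?P closure_of (e ` branches)) \<inter> B) ` \<D> \<lesssim> \<B>"
        using \<D>(2) image_lepoll lepoll_trans by blast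
    qed
  qed
  moreover have "gdelta_in Z (e ` branches)"
    by (rule gdelta_in_branch_space_image[OF H emb dense])
  moreover obtain g where "continuous_map (subtopology Z (e ` branches)) X g"
    "open_map (subtopology Z (e ` branches)) X g" "g ` e ` branches = topspace X"
    using embedding_map_inverse[OF emb continuous_map_branch_space_snd open_map_branch_space_snd]
      snd_image_branches by auto
  ultimately show ?thesis
    unfolding small_gdelta_cover_def by blast
qed

text \<open>A Hausdorff space distinguishes its points by the basic sets containing them, so
  \<open>X\<close> is finite and discrete, and a discrete copy of it serves as
  \<open>Z\<close>.\<close>

lemma small_gdelta_cover_if_finite_basis:
  assumes "Hausdorff_space X" "is_basis X \<B>" "finite \<B>"
  shows "\<exists>Z. small_gdelta_cover X Z"
proof -
  have "inj_on (\<lambda>x. {B \<in> \<B>. x \<in> B}) (topspace X)"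
  proof (rule inj_onI, rule ccontr)
    fix x y assume xy: "x \<in> topspace X" "y \<in> topspace X" "{B \<in> \<B>. x \<in> B} = {B \<in> \<B>. y \<in> B}" "x \<noteq> y"
    then obtain U where U: "openin X U" "x \<in> U" "y \<notin> U"
      using assms(1) unfolding Hausdorff_space_def by (metis disjnt_iff)
    then obtain B where "B \<in> \<B>" "x \<in> B" "B \<subseteq> U"
      using assms(2) unfolding is_basis_def by meson
    then show False using xy(3) U(3) by blast
  qed
  then have fin: "finite (topspace X)"
    by (rule inj_on_finite[where B = "Pow \<B>"]) (use assms(3) in auto)
  then have X: "X = discrete_topology (topspace X)"
    using finite_t1_space_imp_discrete_topology Hausdorff_imp_t1_space[OF assms(1)] by blast
  \<comment> \<open>The indicator of the singleton merely injects \<open>X\<close> into the type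
    prescribed for \<open>Z\<close>.\<close>
  define e :: "'a \<Rightarrow> 'a set \<Rightarrow> real" where "e x A = of_bool (A = {x})" for x A
  have inj: "inj_on e S" for S
  proof (rule inj_onI)
    fix x y assume "e x = e y"
    then have "e x {x} = e y {x}" by simp
    then show "x = y" by (simp add: e_def split: if_splits)
  qed
  define Z where "Z = discrete_topology (e ` topspace X)"
  have "compact_space Z" "Hausdorff_space Z"
    using fin by (simp_all add: Z_def compact_space_discrete_topology)
  moreover have "gdelta_in Z (topspace Z)"
    by simp
  moreover have "weight_le Z X"
    unfolding weight_le_def
  proof (intro allI impI exI conjI)
    fix \<C> assume \<C>: "is_basis X \<C>"
    show "is_basis Z ((\<lambda>x. {e x}) ` topspace X)"
      unfolding is_basis_def Z_def by auto
    \<comment> \<open>Every basis of a discrete space contains all singletons, so it is at least as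
      large as the basis of singletons chosen for \<open>Z\<close>.\<close>
    have "{x} \<in> \<C>" if "x \<in> topspace X" for x
    proof -
      have "openin X {x}" using X that by (metis empty_subsetI insert_subset openin_discrete_topology)
      then obtain V where "V \<in> \<C>" "x \<in> V" "V \<subseteq> {x}"
        using \<C> unfolding is_basis_def by (meson insertI1)
      moreover from this have "V = {x}" by blast
      ultimately show ?thesis by simp
    qed
    then have "(\<lambda>x. {x}) ` topspace X \<subseteq> \<C>" by blast
    then have "topspace X \<lesssim> \<C>"
      unfolding lepoll_def by (intro exI[of _ "\<lambda>x. {x}"]) auto
    then show "(\<lambda>x. {e x}) ` topspace X \<lesssim> \<C>"
      using image_lepoll lepoll_trans by blast
  qed
  moreover have "\<exists>g. continuous_map Z X g \<and> open_map Z X g \<and> g ` topspace Z = topspace X"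
  proof (intro exI conjI)
    let ?g = "inv_into (topspace X) e"
    show im: "?g ` topspace Z = topspace X"
      by (simp add: Z_def inj inv_into_image_cancel)
    show "continuous_map Z X ?g"
      using im by (auto simp: Z_def)
    show "open_map Z X ?g"
      unfolding open_map_def
    proof (intro allI impI)
      fix U assume "openin Z U"
      then have "?g ` U \<subseteq> topspace X" using im openin_subset by blast
      then show "openin X (?g ` U)" using X by (metis openin_discrete_topology)
    qed
  qed
  ultimately show ?thesis
    unfolding small_gdelta_cover_def by (metis subtopology_topspace)
qed

theorem mainTheorem18:
  fixes X :: "'a topology"
  assumes "interpretable_via TYPE('b) TYPE('c) X"
  shows "(\<exists>(Z::('a set \<Rightarrow> real) topology) S g.
            compact_space Z \<and> Hausdorff_space Z \<and> gdelta_in Z S \<and> weight_le Z X \<and>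
            continuous_map (subtopology Z S) X g \<and> open_map (subtopology Z S) X g \<and>
            g ` S = topspace X)
         \<and> (second_countable X \<longrightarrow> Polish_space X)"
proof
  have X: "regular_space X" "Hausdorff_space X"
    using assms unfolding interpretable_via_def by auto
  obtain \<B> where \<B>: "is_basis X \<B>" "\<And>\<C>. is_basis X \<C> \<Longrightarrow> \<B> \<lesssim> \<C>"
    using exists_minimal_basis[of X] by blast
  have "\<exists>Z. small_gdelta_cover X Z"
  proof (cases "finite \<B>")
    case True
    then show ?thesis using small_gdelta_cover_if_finite_basis[OF X(2) \<B>(1)] by blast
  next
    case False
    obtain N where "N \<subseteq> lists \<B>" "sieve X N"
      using interpretable_imp_sieve[OF assms \<B>(1)] by blast
    with False show ?thesis
      using small_gdelta_cover_if_infinite_basis X \<B> by blast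
  qed
  then show "\<exists>(Z::('a set \<Rightarrow> real) topology) S g.
            compact_space Z \<and> Hausdorff_space Z \<and> gdelta_in Z S \<and> weight_le Z X \<and>
            continuous_map (subtopology Z S) X g \<and> open_map (subtopology Z S) X g \<and>
            g ` S = topspace X"
    unfolding small_gdelta_cover_def by blast
  show "second_countable X \<longrightarrow> Polish_space X"
  proof
    assume "second_countable X"
    then obtain \<A> where \<A>: "countable \<A>" "is_basis X \<A>"
      unfolding second_countable_iff_basis by blast
    \<comment> \<open>A sieve over a countable basis is used here, since the count of nodes must be
      countable for the F-sigma union.\<close>
    obtain N where "N \<subseteq> lists \<A>" "sieve X N"
      using interpretable_imp_sieve[OF assms \<A>(2)] by blast
    then show "Polish_space X"
      using Polish_space_if_sieve \<A> X by blast
  qed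
qed

end
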